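(* For every $\mathbf{a}\in l^{2}$ and every $t\in\mathbb{R}$, $$e^{tH}\mathbf{a}=\mathrm{sinc}(t)\,\mathbf{a}+t\,\mathrm{sinc}(t)\,H\mathbf{a}+\sum_{k\in\mathbb{Z}\setminus\{0\}}\frac{t}{k}\,\mathrm{sinc}(t-k)\,e^{kH}\mathbf{a},$$ where the series converges in the norm of $l^{2}$.
   Context: $l^{2}$ is the Hilbert space of square-summable complex sequences $\mathbf{a}=(a_n)_{n\in\mathbb{Z}}$. $H:l^2\to l^2$ is the bounded operator $H=\pi\widetilde H$, where $\widetilde H$ is the discrete Hilbert transform; explicitly $(H\mathbf{a})_m=\sum_{n\in\mathbb{Z},\,n\neq m}\frac{a_n}{m-n}$, $m\in\mathbb{Z}$. For $t\in\mathbb{R}$, $e^{tH}=\sum_{k=0}^{\infty}\frac{t^kH^k}{k!}$. The function $\mathrm{sinc}$ is $\mathrm{sinc}(t)=\frac{\sin(\pi t)}{\pi t}$ for $t\neq0$, $\mathrm{sinc}(0)=1$. *)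

theory Defs
  imports "HOL-Analysis.Analysis"
begin

section \<open>The Hilbert space of square-summable complex sequences indexed by the integers\<close>

definition square_summable :: "(int \<Rightarrow> complex) \<Rightarrow> bool" where
  "square_summable a \<longleftrightarrow> (\<lambda>n. (cmod (a n))\<^sup>2) summable_on UNIV"

lemma square_summable_0: "square_summable (\<lambda>_. 0)"
  by (simp add: square_summable_def)

lemma square_summable_add:
  assumes "square_summable a" "square_summable b"
  shows "square_summable (\<lambda>n. a n + b n)"
proof -
  have "(\<lambda>n. 2 * (cmod (a n))\<^sup>2 + 2 * (cmod (b n))\<^sup>2) summable_on UNIV"
    using assms unfolding square_summable_def
    by (intro summable_on_add summable_on_cmult_right)
  moreover have "(cmod (a n + b n))\<^sup>2 \<le> 2 * (cmod (a n))\<^sup>2 + 2 * (cmod (b n))\<^sup>2" for n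
  proof -
    have "(cmod (a n + b n))\<^sup>2 \<le> (cmod (a n) + cmod (b n))\<^sup>2"
      by (intro power_mono norm_triangle_ineq) auto
    also have "\<dots> \<le> 2 * (cmod (a n))\<^sup>2 + 2 * (cmod (b n))\<^sup>2"
      using zero_le_power2[of "cmod (a n) - cmod (b n)"]
      by (simp add: power2_eq_square algebra_simps)
    finally show ?thesis .
  qed
  ultimately show ?thesis
    unfolding square_summable_def by (rule summable_on_comparison_test) auto
qed

lemma square_summable_scaleR:
  assumes "square_summable a"
  shows "square_summable (\<lambda>n. r *\<^sub>R a n)"
  using summable_on_cmult_right[OF assms[unfolded square_summable_def], of "r\<^sup>2"]
  by (simp add: square_summable_def power_mult_distrib)

lemma square_summable_uminus: "square_summable a \<Longrightarrow> square_summable (\<lambda>n. - a n)"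
  by (simp add: square_summable_def)

lemma square_summable_diff:
  "square_summable a \<Longrightarrow> square_summable b \<Longrightarrow> square_summable (\<lambda>n. a n - b n)"
  using square_summable_add[of a "\<lambda>n. - b n"] square_summable_uminus[of b] by simp

typedef ell2 = "{a. square_summable a}"
  morphisms ell2_nth Abs_ell2
  using square_summable_0 by blast

setup_lifting type_definition_ell2

lemma square_summable_ell2_nth: "square_summable (ell2_nth a)"
  using ell2_nth by blast

lemma summable_on_ell2: "(\<lambda>n. (cmod (ell2_nth a n))\<^sup>2) summable_on UNIV"
  using square_summable_ell2_nth by (simp add: square_summable_def)

lemma summable_on_ell2_prod:
  "(\<lambda>n. Re (ell2_nth a n * cnj (ell2_nth b n))) summable_on UNIV"
proof -
  have summ: "(\<lambda>n. (cmod (ell2_nth a n))\<^sup>2 + (cmod (ell2_nth b n))\<^sup>2) summable_on UNIV"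
    by (intro summable_on_add summable_on_ell2)
  have bound: "norm (Re (ell2_nth a n * cnj (ell2_nth b n)))
      \<le> (cmod (ell2_nth a n))\<^sup>2 + (cmod (ell2_nth b n))\<^sup>2" for n
  proof -
    have "norm (Re (ell2_nth a n * cnj (ell2_nth b n))) \<le> cmod (ell2_nth a n) * cmod (ell2_nth b n)"
      using abs_Re_le_cmod[of "ell2_nth a n * cnj (ell2_nth b n)"] by (simp add: norm_mult)
    also have "\<dots> \<le> (cmod (ell2_nth a n))\<^sup>2 + (cmod (ell2_nth b n))\<^sup>2"
      using zero_le_power2[of "cmod (ell2_nth a n) - cmod (ell2_nth b n)"]
        mult_nonneg_nonneg[OF norm_ge_zero norm_ge_zero, of "ell2_nth a n" "ell2_nth b n"]
      unfolding power2_diff by linarith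
    finally show ?thesis .
  qed
  have "(\<lambda>n. norm (Re (ell2_nth a n * cnj (ell2_nth b n)))) summable_on UNIV"
    by (rule Infinite_Sum.abs_summable_on_comparison_test'[OF summ]) (rule bound)
  then show ?thesis by (rule abs_summable_summable)
qed

text \<open>
  The space is equipped with its real-linear structure only: the type classes for normed spaces and
  the type of bounded linear operators are real.  All scalars occurring in the expansion of
  \<open>e\<^sup>t\<^sup>H\<close> are real, and the inner product below, the real part of the Hermitian one, induces the
  usual norm.
\<close>

instantiation ell2 :: real_vector
begin

lift_definition zero_ell2 :: ell2 is "\<lambda>_. 0" by (rule square_summable_0)
lift_definition plus_ell2 :: "ell2 \<Rightarrow> ell2 \<Rightarrow> ell2" is "\<lambda>a b n. a n + b n"
  by (rule square_summable_add)
lift_definition minus_ell2 :: "ell2 \<Rightarrow> ell2 \<Rightarrow> ell2" is "\<lambda>a b n. a n - b n"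
  by (rule square_summable_diff)
lift_definition uminus_ell2 :: "ell2 \<Rightarrow> ell2" is "\<lambda>a n. - a n"
  by (rule square_summable_uminus)
lift_definition scaleR_ell2 :: "real \<Rightarrow> ell2 \<Rightarrow> ell2" is "\<lambda>r a n. r *\<^sub>R a n"
  by (rule square_summable_scaleR)

instance
  by standard (transfer; simp add: algebra_simps)+

end

lemmas ell2_nth_simps [simp] =
  zero_ell2.rep_eq plus_ell2.rep_eq minus_ell2.rep_eq uminus_ell2.rep_eq scaleR_ell2.rep_eq

lemma ell2_eqI: "(\<And>n. ell2_nth a n = ell2_nth b n) \<Longrightarrow> a = b"
  by (metis ell2_nth_inject ext)

instantiation ell2 :: real_inner
begin

definition inner_ell2 :: "ell2 \<Rightarrow> ell2 \<Rightarrow> real" where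
  "inner_ell2 a b = (\<Sum>\<^sub>\<infinity>n. Re (ell2_nth a n * cnj (ell2_nth b n)))"

definition norm_ell2 :: "ell2 \<Rightarrow> real" where
  "norm_ell2 a = sqrt (\<Sum>\<^sub>\<infinity>n. (cmod (ell2_nth a n))\<^sup>2)"

definition sgn_ell2 :: "ell2 \<Rightarrow> ell2" where
  "sgn_ell2 a = a /\<^sub>R norm a"

definition dist_ell2 :: "ell2 \<Rightarrow> ell2 \<Rightarrow> real" where
  "dist_ell2 a b = norm (a - b)"

definition uniformity_ell2 :: "(ell2 \<times> ell2) filter" where
  "uniformity_ell2 = (INF e\<in>{0<..}. principal {(a, b). dist a b < e})"

definition open_ell2 :: "ell2 set \<Rightarrow> bool" where
  "open_ell2 U \<longleftrightarrow> (\<forall>x\<in>U. eventually (\<lambda>(x', y). x' = x \<longrightarrow> y \<in> U) uniformity)"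

instance
proof
  have self: "Re (z * cnj z) = (cmod z)\<^sup>2" for z
    by (simp only: complex_mult_cnj cmod_power2 Re_complex_of_real)
  fix a b c :: ell2 and r :: real and U :: "ell2 set"
  show "dist a b = norm (a - b)" by (rule dist_ell2_def)
  show "sgn a = a /\<^sub>R norm a" by (rule sgn_ell2_def)
  show "uniformity = (INF e\<in>{0<..}. principal {(a::ell2, b). dist a b < e})"
    by (rule uniformity_ell2_def)
  show "open U \<longleftrightarrow> (\<forall>x\<in>U. eventually (\<lambda>(x', y). x' = x \<longrightarrow> y \<in> U) uniformity)"
    by (rule open_ell2_def)
  show "inner a b = inner b a"
    unfolding inner_ell2_def by (intro infsum_cong) simp
  show "inner (a + b) c = inner a c + inner b c"
    unfolding inner_ell2_def
    by (subst infsum_add[OF summable_on_ell2_prod summable_on_ell2_prod, symmetric])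
       (intro infsum_cong, simp add: algebra_simps)
  show "inner (r *\<^sub>R a) b = r * inner a b"
    unfolding inner_ell2_def
    by (subst infsum_cmult_right'[symmetric]) (intro infsum_cong, simp add: algebra_simps)
  show "0 \<le> inner a a"
    unfolding inner_ell2_def self by (intro infsum_nonneg) simp
  show "norm a = sqrt (inner a a)"
    unfolding inner_ell2_def norm_ell2_def self ..
  show "inner a a = 0 \<longleftrightarrow> a = 0"
  proof
    assume "inner a a = 0"
    then have "(\<Sum>\<^sub>\<infinity>n. (cmod (ell2_nth a n))\<^sup>2) = 0"
      unfolding inner_ell2_def self .
    then have "(cmod (ell2_nth a n))\<^sup>2 = 0" for n
      using nonneg_infsum_le_0D[OF _ summable_on_ell2, of a n] by simp
    then show "a = 0" by (intro ell2_eqI) simp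
  qed (simp add: inner_ell2_def)
qed

end

lemma norm_ell2_sq: "(norm a)\<^sup>2 = (\<Sum>\<^sub>\<infinity>n. (cmod (ell2_nth a n))\<^sup>2)"
  by (simp add: norm_ell2_def infsum_nonneg)

lemma sum_le_norm_ell2_sq:
  "finite F \<Longrightarrow> (\<Sum>n\<in>F. (cmod (ell2_nth a n))\<^sup>2) \<le> (norm a)\<^sup>2"
  unfolding norm_ell2_sq by (intro finite_sum_le_infsum summable_on_ell2) auto

lemma cmod_ell2_nth_le: "cmod (ell2_nth a n) \<le> norm a"
  by (rule power2_le_imp_le) (use sum_le_norm_ell2_sq[of "{n}" a] in auto)

lemma square_summable_bounded:
  assumes "\<And>F. finite F \<Longrightarrow> (\<Sum>n\<in>F. (cmod (f n))\<^sup>2) \<le> C"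
  shows "square_summable f" "(\<Sum>\<^sub>\<infinity>n. (cmod (f n))\<^sup>2) \<le> C"
proof -
  show s: "square_summable f"
    unfolding square_summable_def
    by (rule nonneg_bdd_above_summable_on) (auto intro!: bdd_aboveI[of _ C] assms)
  show "(\<Sum>\<^sub>\<infinity>n. (cmod (f n))\<^sup>2) \<le> C"
    by (rule infsum_le_finite_sums[OF s[unfolded square_summable_def]]) (auto intro: assms)
qed

instance ell2 :: banach
proof
  fix X :: "nat \<Rightarrow> ell2"
  assume X: "Cauchy X"
  have "Cauchy (\<lambda>k. ell2_nth (X k) n)" for n
  proof (rule CauchyI)
    fix e :: real assume "0 < e"
    with X obtain M where M: "\<forall>j\<ge>M. \<forall>k\<ge>M. norm (X j - X k) < e"
      by (auto simp: Cauchy_iff)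
    show "\<exists>M. \<forall>j\<ge>M. \<forall>k\<ge>M. norm (ell2_nth (X j) n - ell2_nth (X k) n) < e"
    proof (intro exI allI impI)
      fix j k assume "M \<le> j" "M \<le> k"
      then have "norm (X j - X k) < e" using M by blast
      then show "norm (ell2_nth (X j) n - ell2_nth (X k) n) < e"
        using cmod_ell2_nth_le[of "X j - X k" n] by simp
    qed
  qed
  then have "\<exists>l. (\<lambda>k. ell2_nth (X k) n) \<longlonglongrightarrow> l" for n
    by (simp add: Cauchy_convergent_iff convergent_def)
  then obtain f where f: "\<And>n. (\<lambda>k. ell2_nth (X k) n) \<longlonglongrightarrow> f n"
    by metis
  have bound: "(\<Sum>n\<in>F. (cmod (ell2_nth (X j) n - f n))\<^sup>2) \<le> e\<^sup>2"
    if "finite F" "0 < e" and M: "\<And>k. k \<ge> M \<Longrightarrow> norm (X j - X k) < e" for e F M j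
  proof (rule tendsto_upperbound)
    show "(\<lambda>k. \<Sum>n\<in>F. (cmod (ell2_nth (X j) n - ell2_nth (X k) n))\<^sup>2)
        \<longlonglongrightarrow> (\<Sum>n\<in>F. (cmod (ell2_nth (X j) n - f n))\<^sup>2)"
      by (intro tendsto_intros f)
    show "\<forall>\<^sub>F k in sequentially.
        (\<Sum>n\<in>F. (cmod (ell2_nth (X j) n - ell2_nth (X k) n))\<^sup>2) \<le> e\<^sup>2"
    proof (rule eventually_sequentiallyI)
      fix k assume "M \<le> k"
      have "(\<Sum>n\<in>F. (cmod (ell2_nth (X j) n - ell2_nth (X k) n))\<^sup>2) \<le> (norm (X j - X k))\<^sup>2"
        using sum_le_norm_ell2_sq[OF \<open>finite F\<close>, of "X j - X k"] by simp
      also have "\<dots> \<le> e\<^sup>2"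
        using M[OF \<open>M \<le> k\<close>] by (intro power_mono) auto
      finally show "(\<Sum>n\<in>F. (cmod (ell2_nth (X j) n - ell2_nth (X k) n))\<^sup>2) \<le> e\<^sup>2" .
    qed
  qed simp
  obtain M1 where M1: "\<And>j k. j \<ge> M1 \<Longrightarrow> k \<ge> M1 \<Longrightarrow> norm (X j - X k) < 1"
    using X unfolding Cauchy_iff by (metis zero_less_one)
  have "square_summable (\<lambda>n. ell2_nth (X M1) n - f n)"
    by (rule square_summable_bounded(1)) (rule bound[where M = M1 and e = 1], auto intro: M1)
  from square_summable_diff[OF square_summable_ell2_nth this, of "X M1"]
  have "square_summable f" by simp
  then obtain L where L: "\<And>n. ell2_nth L n = f n"
    by (metis Abs_ell2_inverse mem_Collect_eq)
  have "X \<longlonglongrightarrow> L"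
  proof (rule LIMSEQ_I)
    fix r :: real assume "0 < r"
    then have "0 < r / 2" by simp
    then obtain M where M: "\<And>j k. j \<ge> M \<Longrightarrow> k \<ge> M \<Longrightarrow> norm (X j - X k) < r / 2"
      using X unfolding Cauchy_iff by metis
    have "norm (X j - L) < r" if "j \<ge> M" for j
    proof -
      have close: "norm (X j - X k) < r / 2" if "k \<ge> M" for k
        by (rule M[OF \<open>j \<ge> M\<close> that])
      have "(\<Sum>\<^sub>\<infinity>n. (cmod (ell2_nth (X j) n - f n))\<^sup>2) \<le> (r / 2)\<^sup>2"
        by (rule square_summable_bounded(2)) (rule bound[OF _ \<open>0 < r / 2\<close> close])
      then have "(norm (X j - L))\<^sup>2 \<le> (r / 2)\<^sup>2"
        unfolding norm_ell2_sq minus_ell2.rep_eq L .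
      then have "norm (X j - L) \<le> r / 2"
        by (rule power2_le_imp_le) (use \<open>0 < r\<close> in simp)
      then show ?thesis using \<open>0 < r\<close> by simp
    qed
    then show "\<exists>M. \<forall>j\<ge>M. norm (X j - L) < r" by blast
  qed
  then show "convergent X" by (auto simp: convergent_def)
qed


section \<open>The discrete Hilbert transform\<close>

text \<open>Without the normalising factor \<open>1 / \<pi>\<close>.\<close>

definition hilbert_seq :: "(int \<Rightarrow> complex) \<Rightarrow> int \<Rightarrow> complex" where
  "hilbert_seq a m = (\<Sum>\<^sub>\<infinity>n\<in>UNIV - {m}. a n / of_int (m - n))"

text \<open>
  Boundedness follows Toeplitz's proof of Hilbert's inequality: \<open>1 / k\<close> is, up to a factor, the
  \<open>k\<close>-th Fourier coefficient of the bounded function \<open>t - \<pi>\<close> on \<open>[0, 2\<pi>]\<close>.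
\<close>

lemma cis_integral:
  "((\<lambda>t. cis (of_int k * t)) has_integral (if k = 0 then of_real (2 * pi) else 0)) {0..2 * pi}"
proof (cases "k = 0")
  case True
  then show ?thesis
    using has_integral_const_real[of "1::complex" 0 "2 * pi"] by (simp add: scaleR_conv_of_real)
next
  case False
  have "((\<lambda>t. cis (of_int k * t)) has_integral
      cis (of_int k * (2 * pi)) / (\<i> * of_int k) - cis (of_int k * 0) / (\<i> * of_int k)) {0..2 * pi}"
  proof (rule fundamental_theorem_of_calculus)
    fix t :: real
    show "((\<lambda>t. cis (of_int k * t) / (\<i> * of_int k)) has_vector_derivative cis (of_int k * t))
        (at t within {0..2 * pi})"
    proof -
      have "((\<lambda>z. exp (\<i> * (of_int k * z)) / (\<i> * of_int k))
          has_field_derivative exp (\<i> * (of_int k * of_real t))) (at (of_real t))"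
        using False by (auto intro!: derivative_eq_intros simp: field_simps)
      from has_vector_derivative_real_field[OF this, of "{0..2 * pi}"]
      show ?thesis unfolding cis_conv_exp by simp
    qed
  qed simp
  moreover have "cis (of_int k * (2 * pi)) = 1"
    using cis_multiple_2pi[of "of_int k"] by (simp add: mult_ac)
  ultimately show ?thesis using False by simp
qed

lemma cis_integral_weighted:
  "((\<lambda>t. of_real (t - pi) * cis (of_int k * t)) has_integral (2 * pi / (\<i> * of_int k))) {0..2 * pi}"
proof (cases "k = 0")
  case True
  have "((\<lambda>t::real. of_real (t - pi)) has_integral
      (of_real ((2 * pi - pi)\<^sup>2 / 2) - of_real ((0 - pi)\<^sup>2 / 2) :: complex)) {0..2 * pi}"
  proof (rule fundamental_theorem_of_calculus)
    fix t :: real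
    have "((\<lambda>t. (t - pi)\<^sup>2 / 2) has_real_derivative t - pi) (at t within {0..2 * pi})"
      by (auto intro!: derivative_eq_intros)
    then show "((\<lambda>t. of_real ((t - pi)\<^sup>2 / 2) :: complex) has_vector_derivative of_real (t - pi))
        (at t within {0..2 * pi})"
      by (intro has_vector_derivative_of_real)
         (simp add: has_real_derivative_iff_has_vector_derivative)
  qed simp
  then show ?thesis using True by simp
next
  case False
  define F :: "real \<Rightarrow> complex" where
    "F = (\<lambda>t. of_real (t - pi) * cis (of_int k * t) / (\<i> * of_int k) + cis (of_int k * t) / (of_int k)\<^sup>2)"
  have "((\<lambda>t. of_real (t - pi) * cis (of_int k * t)) has_integral F (2 * pi) - F 0) {0..2 * pi}"
  proof (rule fundamental_theorem_of_calculus)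
    fix t :: real
    show "(F has_vector_derivative of_real (t - pi) * cis (of_int k * t)) (at t within {0..2 * pi})"
    proof -
      have "((\<lambda>z. (z - of_real pi) * exp (\<i> * (of_int k * z)) / (\<i> * of_int k)
            + exp (\<i> * (of_int k * z)) / (of_int k)\<^sup>2)
          has_field_derivative of_real (t - pi) * exp (\<i> * (of_int k * of_real t))) (at (of_real t))"
        using False by (auto intro!: derivative_eq_intros simp: field_simps power2_eq_square)
      from has_vector_derivative_real_field[OF this, of "{0..2 * pi}"]
      show ?thesis unfolding F_def cis_conv_exp by (simp add: of_real_diff)
    qed
  qed simp
  moreover have "cis (of_int k * (2 * pi)) = 1"
    using cis_multiple_2pi[of "of_int k"] by (simp add: mult_ac)
  moreover have "complex_of_real (2 * pi - pi) / c + d - (complex_of_real (0 - pi) / c + d)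
      = complex_of_real (2 * pi) / c" for c d :: complex
    by (simp add: add_divide_distrib[symmetric])
  ultimately show ?thesis by (simp only: F_def mult_zero_right cis_zero mult_1_right)
qed


lemma trig_sum_integral:
  fixes w :: "real \<Rightarrow> complex" and c :: "int \<Rightarrow> complex"
  assumes w: "\<And>k. ((\<lambda>t. w t * cis (of_int k * t)) has_integral c k) {0..2 * pi}"
    and "finite F" "finite M"
  shows "((\<lambda>t. w t * ((\<Sum>n\<in>F. a n * cis (- of_int n * t)) * cnj (\<Sum>m\<in>M. b m * cis (- of_int m * t))))
    has_integral (\<Sum>m\<in>M. \<Sum>n\<in>F. a n * cnj (b m) * c (m - n))) {0..2 * pi}"
proof -
  have "((\<lambda>t. \<Sum>m\<in>M. \<Sum>n\<in>F. (a n * cnj (b m)) * (w t * cis (of_int (m - n) * t)))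
      has_integral (\<Sum>m\<in>M. \<Sum>n\<in>F. a n * cnj (b m) * c (m - n))) {0..2 * pi}"
    by (intro has_integral_sum assms has_integral_mult_right)
  moreover have "(\<Sum>m\<in>M. \<Sum>n\<in>F. (a n * cnj (b m)) * (w t * cis (of_int (m - n) * t)))
      = w t * ((\<Sum>n\<in>F. a n * cis (- of_int n * t)) * cnj (\<Sum>m\<in>M. b m * cis (- of_int m * t)))" for t
  proof -
    have "cis (of_int (m - n) * t) = cis (- of_int n * t) * cis (of_int m * t)" for m n :: int
      by (simp add: cis_mult algebra_simps)
    then show ?thesis
      by (simp add: cnj_sum sum_product sum_distrib_left cis_cnj mult_ac)
  qed
  ultimately show ?thesis by simp
qed

lemma trig_sum_norm_integral:
  assumes "finite F"
  shows "((\<lambda>t. (cmod (\<Sum>n\<in>F. a n * cis (- of_int n * t)))\<^sup>2)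
    has_integral 2 * pi * (\<Sum>n\<in>F. (cmod (a n))\<^sup>2)) {0..2 * pi}"
proof -
  let ?c = "\<lambda>k::int. if k = 0 then complex_of_real (2 * pi) else 0"
  have self: "Re (z * cnj z) = (cmod z)\<^sup>2" for z
    by (simp only: complex_mult_cnj cmod_power2 Re_complex_of_real)
  have "((\<lambda>t. 1 * ((\<Sum>n\<in>F. a n * cis (- of_int n * t)) * cnj (\<Sum>n\<in>F. a n * cis (- of_int n * t))))
      has_integral (\<Sum>m\<in>F. \<Sum>n\<in>F. a n * cnj (a m) * ?c (m - n))) {0..2 * pi}"
    by (rule trig_sum_integral) (use assms cis_integral in auto)
  from has_integral_linear[OF this bounded_linear_Re]
  have "((\<lambda>t. (cmod (\<Sum>n\<in>F. a n * cis (- of_int n * t)))\<^sup>2)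
      has_integral Re (\<Sum>m\<in>F. \<Sum>n\<in>F. a n * cnj (a m) * ?c (m - n))) {0..2 * pi}"
    by (simp only: o_def mult_1 self)
  moreover have "(\<Sum>m\<in>F. \<Sum>n\<in>F. a n * cnj (a m) * ?c (m - n))
      = (\<Sum>m\<in>F. of_real (2 * pi * (cmod (a m))\<^sup>2))"
  proof (rule sum.cong)
    fix m assume m: "m \<in> F"
    have "(\<Sum>n\<in>F. a n * cnj (a m) * ?c (m - n)) =
        (\<Sum>n\<in>F. if n = m then a m * cnj (a m) * of_real (2 * pi) else 0)"
      by (intro sum.cong) auto
    also have "\<dots> = a m * cnj (a m) * of_real (2 * pi)"
      using assms m by simp
    also have "\<dots> = of_real (2 * pi * (cmod (a m))\<^sup>2)"
      by (subst complex_norm_square[symmetric]) simp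
    finally show "(\<Sum>n\<in>F. a n * cnj (a m) * ?c (m - n)) = of_real (2 * pi * (cmod (a m))\<^sup>2)" .
  qed simp
  ultimately show ?thesis
    by (simp only: Re_sum Re_complex_of_real sum_distrib_left)
qed

lemma hilbert_form_bound:
  assumes "finite F" "finite M"
  shows "cmod (\<Sum>m\<in>M. \<Sum>n\<in>F. a n * cnj (b m) / of_int (m - n))
    \<le> pi\<^sup>2 / 2 * (\<Sum>n\<in>F. (cmod (a n))\<^sup>2) + (\<Sum>m\<in>M. (cmod (b m))\<^sup>2) / 2"
proof -
  define A where "A = (\<lambda>t::real. \<Sum>n\<in>F. a n * cis (- of_int n * t))"
  define B where "B = (\<lambda>t::real. \<Sum>m\<in>M. b m * cis (- of_int m * t))"
  define Q where "Q = (\<Sum>m\<in>M. \<Sum>n\<in>F. a n * cnj (b m) / of_int (m - n))"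
  define S where "S = (\<Sum>n\<in>F. (cmod (a n))\<^sup>2)"
  define T where "T = (\<Sum>m\<in>M. (cmod (b m))\<^sup>2)"
  have "(\<Sum>m\<in>M. \<Sum>n\<in>F. a n * cnj (b m) * (2 * pi / (\<i> * of_int (m - n)))) = 2 * pi / \<i> * Q"
    unfolding Q_def sum_distrib_left by (intro sum.cong refl) (simp only: divide_inverse inverse_mult_distrib mult_ac)
  with trig_sum_integral[OF cis_integral_weighted assms, of a b]
  have 1: "((\<lambda>t. of_real (t - pi) * (A t * cnj (B t))) has_integral 2 * pi / \<i> * Q) {0..2 * pi}"
    unfolding A_def B_def by (simp only:)
  have A2: "((\<lambda>t. (cmod (A t))\<^sup>2) has_integral 2 * pi * S) {0..2 * pi}"
    unfolding A_def S_def by (rule trig_sum_norm_integral[OF assms(1)])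
  have B2: "((\<lambda>t. (cmod (B t))\<^sup>2) has_integral 2 * pi * T) {0..2 * pi}"
    unfolding B_def T_def by (rule trig_sum_norm_integral[OF assms(2)])
  have 2: "((\<lambda>t. pi\<^sup>2 / 2 * (cmod (A t))\<^sup>2 + 1 / 2 * (cmod (B t))\<^sup>2)
      has_integral pi\<^sup>2 / 2 * (2 * pi * S) + 1 / 2 * (2 * pi * T)) {0..2 * pi}"
    by (intro has_integral_add has_integral_mult_right A2 B2)
  have "norm (integral {0..2 * pi} (\<lambda>t. of_real (t - pi) * (A t * cnj (B t))))
      \<le> integral {0..2 * pi} (\<lambda>t. pi\<^sup>2 / 2 * (cmod (A t))\<^sup>2 + 1 / 2 * (cmod (B t))\<^sup>2)"
  proof (rule integral_norm_bound_integral)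
    fix t assume "t \<in> {0..2 * pi}"
    then have "\<bar>t - pi\<bar> \<le> pi" by auto
    then have "norm (of_real (t - pi) * (A t * cnj (B t))) \<le> pi * (cmod (A t) * cmod (B t))"
      by (simp only: norm_mult norm_of_real complex_mod_cnj) (intro mult_right_mono, auto)
    also have "\<dots> \<le> pi\<^sup>2 / 2 * (cmod (A t))\<^sup>2 + 1 / 2 * (cmod (B t))\<^sup>2"
      using zero_le_power2[of "pi * cmod (A t) - cmod (B t)"]
      by (simp add: power2_eq_square algebra_simps)
    finally show "norm (of_real (t - pi) * (A t * cnj (B t)))
        \<le> pi\<^sup>2 / 2 * (cmod (A t))\<^sup>2 + 1 / 2 * (cmod (B t))\<^sup>2" .
  qed (use 1 2 in \<open>blast dest: has_integral_integrable\<close>)+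
  then have "norm (2 * pi / \<i> * Q) \<le> pi\<^sup>2 / 2 * (2 * pi * S) + 1 / 2 * (2 * pi * T)"
    unfolding integral_unique[OF 1] integral_unique[OF 2] .
  then have "2 * pi * cmod Q \<le> 2 * pi * (pi\<^sup>2 / 2 * S + T / 2)"
    by (simp add: norm_mult norm_divide algebra_simps)
  then have "cmod Q \<le> pi\<^sup>2 / 2 * S + T / 2"
    using pi_gt_zero by (subst (asm) mult_le_cancel_left_pos) auto
  then show ?thesis unfolding Q_def S_def T_def .
qed

lemma hilbert_finite_bound:
  assumes "finite F" "finite M"
  shows "(\<Sum>m\<in>M. (cmod (\<Sum>n\<in>F. a n / of_int (m - n)))\<^sup>2) \<le> pi\<^sup>2 * (\<Sum>n\<in>F. (cmod (a n))\<^sup>2)"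
proof -
  define b where "b = (\<lambda>m. \<Sum>n\<in>F. a n / of_int (m - n))"
  define T where "T = (\<Sum>m\<in>M. (cmod (b m))\<^sup>2)"
  have "(\<Sum>m\<in>M. \<Sum>n\<in>F. a n * cnj (b m) / of_int (m - n)) = (\<Sum>m\<in>M. b m * cnj (b m))"
    unfolding b_def by (simp only: sum_distrib_right times_divide_eq_left)
  also have "\<dots> = of_real T"
    unfolding T_def of_real_sum complex_norm_square ..
  finally have "cmod (of_real T) \<le> pi\<^sup>2 / 2 * (\<Sum>n\<in>F. (cmod (a n))\<^sup>2) + T / 2"
    using hilbert_form_bound[OF assms, of a b] unfolding T_def by simp
  then have "T \<le> pi\<^sup>2 / 2 * (\<Sum>n\<in>F. (cmod (a n))\<^sup>2) + T / 2"
    using abs_ge_self[of T] by simp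
  then show ?thesis unfolding T_def b_def by simp
qed

lemma summable_on_hilbert:
  "(\<lambda>n. ell2_nth a n / of_int (m - n)) summable_on (UNIV - {m})"
proof -
  have "(\<lambda>n. 1 / (real_of_int n)\<^sup>2) summable_on UNIV"
  proof -
    have nat: "(\<lambda>n. 1 / (real n)\<^sup>2) summable_on UNIV"
      using inverse_power_summable[of 2, where 'a = real]
      by (simp add: summable_on_UNIV_nonneg_real_iff field_simps)
    have "(\<lambda>n. 1 / (real_of_int n)\<^sup>2) summable_on range int"
      using nat by (subst summable_on_reindex) (simp_all add: o_def)
    moreover have "(\<lambda>n. 1 / (real_of_int n)\<^sup>2) summable_on range (\<lambda>n. - int n)"
      using nat by (subst summable_on_reindex) (simp_all add: o_def inj_on_def)
    moreover have "range int \<union> range (\<lambda>n. - int n) = UNIV"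
      by (auto simp: image_iff) (metis int_cases2)
    ultimately show ?thesis
      using summable_on_union by metis
  qed
  then have "(\<lambda>n. 1 / (real_of_int (m - n))\<^sup>2) summable_on UNIV"
    by (rule summable_on_reindex_bij_betw[THEN iffD2, rotated])
       (rule bij_betwI[where g = "\<lambda>n. m - n"], auto)
  then have "(\<lambda>n. (cmod (ell2_nth a n))\<^sup>2 + 1 / (real_of_int (m - n))\<^sup>2) summable_on UNIV"
    by (intro summable_on_add summable_on_ell2)
  then have "(\<lambda>n. norm (ell2_nth a n / of_int (m - n))) summable_on UNIV"
  proof (rule Infinite_Sum.abs_summable_on_comparison_test')
    fix n
    have "norm (ell2_nth a n / of_int (m - n)) = cmod (ell2_nth a n) * \<bar>1 / of_int (m - n)\<bar>"
      by (simp add: norm_divide flip: of_int_diff)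
    also have "\<dots> \<le> (cmod (ell2_nth a n))\<^sup>2 + \<bar>1 / of_int (m - n)\<bar>\<^sup>2"
      using zero_le_power2[of "cmod (ell2_nth a n) - \<bar>1 / of_int (m - n)\<bar>"]
        mult_nonneg_nonneg[OF norm_ge_zero abs_ge_zero, of "ell2_nth a n" "1 / of_int (m - n)"]
      unfolding power2_diff by linarith
    finally show "norm (ell2_nth a n / of_int (m - n)) \<le> (cmod (ell2_nth a n))\<^sup>2 + 1 / (real_of_int (m - n))\<^sup>2"
      by (simp add: power_divide)
  qed
  then have "(\<lambda>n. ell2_nth a n / of_int (m - n)) summable_on UNIV"
    by (rule abs_summable_summable)
  then show ?thesis
    by (rule summable_on_subset_banach) simp
qed

lemma hilbert_seq_UNIV: "hilbert_seq a m = (\<Sum>\<^sub>\<infinity>n. a n / of_int (m - n))"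
  unfolding hilbert_seq_def by (rule infsum_cong_neutral) auto

lemma hilbert_seq_tendsto:
  "((\<lambda>F. \<Sum>n\<in>F. ell2_nth a n / of_int (m - n)) \<longlongrightarrow> hilbert_seq (ell2_nth a) m) (finite_subsets_at_top UNIV)"
proof -
  have "(\<lambda>n. ell2_nth a n / of_int (m - n)) summable_on UNIV"
    by (subst summable_on_cong_neutral[where T = "UNIV - {m}"]) (auto intro: summable_on_hilbert simp del: of_int_diff)
  then show ?thesis
    unfolding hilbert_seq_UNIV by (rule infsum_tendsto)
qed

lemma hilbert_seq_bound:
  assumes "finite M"
  shows "(\<Sum>m\<in>M. (cmod (hilbert_seq (ell2_nth a) m))\<^sup>2) \<le> (pi * norm a)\<^sup>2"
proof (rule tendsto_upperbound)
  show "((\<lambda>F. \<Sum>m\<in>M. (cmod (\<Sum>n\<in>F. ell2_nth a n / of_int (m - n)))\<^sup>2)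
      \<longlongrightarrow> (\<Sum>m\<in>M. (cmod (hilbert_seq (ell2_nth a) m))\<^sup>2)) (finite_subsets_at_top UNIV)"
    by (intro tendsto_intros hilbert_seq_tendsto)
  show "\<forall>\<^sub>F F in finite_subsets_at_top UNIV.
      (\<Sum>m\<in>M. (cmod (\<Sum>n\<in>F. ell2_nth a n / of_int (m - n)))\<^sup>2) \<le> (pi * norm a)\<^sup>2"
  proof (rule eventually_finite_subsets_at_top_weakI)
    fix F :: "int set" assume "finite F"
    have "(\<Sum>m\<in>M. (cmod (\<Sum>n\<in>F. ell2_nth a n / of_int (m - n)))\<^sup>2)
        \<le> pi\<^sup>2 * (\<Sum>n\<in>F. (cmod (ell2_nth a n))\<^sup>2)"
      by (rule hilbert_finite_bound[OF \<open>finite F\<close> assms])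
    also have "\<dots> \<le> pi\<^sup>2 * (norm a)\<^sup>2"
      by (intro mult_left_mono sum_le_norm_ell2_sq \<open>finite F\<close>) auto
    finally show "(\<Sum>m\<in>M. (cmod (\<Sum>n\<in>F. ell2_nth a n / of_int (m - n)))\<^sup>2) \<le> (pi * norm a)\<^sup>2"
      by (simp add: power_mult_distrib)
  qed
qed simp

lift_definition hilbert_ell2 :: "ell2 \<Rightarrow> ell2" is hilbert_seq
proof -
  fix a assume "square_summable a"
  then obtain x where "a = ell2_nth x"
    by (metis Abs_ell2_inverse mem_Collect_eq)
  then show "square_summable (hilbert_seq a)"
    using square_summable_bounded(1)[OF hilbert_seq_bound] by simp
qed

lemma bounded_linear_hilbert_ell2: "bounded_linear hilbert_ell2"
proof (rule bounded_linear_intro)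
  fix a b :: ell2 and r :: real
  show "hilbert_ell2 (a + b) = hilbert_ell2 a + hilbert_ell2 b"
    by (rule ell2_eqI)
       (simp add: hilbert_ell2.rep_eq hilbert_seq_def add_divide_distrib infsum_add summable_on_hilbert
         del: of_int_diff)
  show "hilbert_ell2 (r *\<^sub>R a) = r *\<^sub>R hilbert_ell2 a"
  proof (rule ell2_eqI)
    fix m
    show "ell2_nth (hilbert_ell2 (r *\<^sub>R a)) m = ell2_nth (r *\<^sub>R hilbert_ell2 a) m"
      unfolding hilbert_ell2.rep_eq scaleR_ell2.rep_eq hilbert_seq_def infsum_scaleR_right[symmetric]
      by (intro infsum_cong) (simp add: scaleR_conv_of_real)
  qed
  have "(norm (hilbert_ell2 a))\<^sup>2 \<le> (pi * norm a)\<^sup>2"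
    unfolding norm_ell2_sq[of "hilbert_ell2 a"] hilbert_ell2.rep_eq
    by (rule square_summable_bounded(2)) (rule hilbert_seq_bound)
  then have "norm (hilbert_ell2 a) \<le> pi * norm a"
    by (rule power2_le_imp_le) simp
  then show "norm (hilbert_ell2 a) \<le> norm a * pi"
    by (simp add: mult.commute)
qed

lift_definition Hilb :: "ell2 \<Rightarrow>\<^sub>L ell2" is hilbert_ell2
  by (rule bounded_linear_hilbert_ell2)

lemma ell2_nth_Hilb: "ell2_nth (blinfun_apply Hilb a) m = (\<Sum>\<^sub>\<infinity>n\<in>UNIV - {m}. ell2_nth a n / of_int (m - n))"
  by (simp add: Hilb.rep_eq hilbert_ell2.rep_eq hilbert_seq_def)


section \<open>The exponential series and the sinc function\<close>

primrec blinfun_pow :: "('a::real_normed_vector \<Rightarrow>\<^sub>L 'a) \<Rightarrow> nat \<Rightarrow> ('a \<Rightarrow>\<^sub>L 'a)" where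
  "blinfun_pow A 0 = id_blinfun"
| "blinfun_pow A (Suc k) = A o\<^sub>L blinfun_pow A k"

lemma norm_blinfun_pow_le: "norm (blinfun_pow A k) \<le> norm A ^ k"
proof (induction k)
  case 0
  show ?case by (simp add: norm_blinfun_id_le)
next
  case (Suc k)
  have "norm (blinfun_pow A (Suc k)) \<le> norm A * norm (blinfun_pow A k)"
    by (simp add: norm_blinfun_compose)
  also have "\<dots> \<le> norm A * norm A ^ k"
    by (intro mult_left_mono Suc norm_ge_zero)
  finally show ?case by simp
qed

text \<open>
  The library function \<open>exp\<close> does not apply to bounded linear operators, whose type is not an
  instance of \<open>real_normed_algebra_1\<close>.  The series below is taken in the operator norm.
\<close>

definition exp_Hilb :: "real \<Rightarrow> ell2 \<Rightarrow>\<^sub>L ell2" where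
  "exp_Hilb t = (\<Sum>k. (t ^ k / fact k) *\<^sub>R blinfun_pow Hilb k)"

lemma summable_exp_Hilb: "summable (\<lambda>k. (t ^ k / fact k) *\<^sub>R blinfun_pow Hilb k)"
proof (rule summable_comparison_test')
  show "summable (\<lambda>k. (\<bar>t\<bar> * norm Hilb) ^ k / fact k)"
    using summable_exp_generic[of "\<bar>t\<bar> * norm Hilb"] by (simp add: field_simps)
  show "norm ((t ^ k / fact k) *\<^sub>R blinfun_pow Hilb k) \<le> (\<bar>t\<bar> * norm Hilb) ^ k / fact k" for k
    using mult_left_mono[OF norm_blinfun_pow_le[of Hilb k], of "\<bar>t\<bar> ^ k / fact k"]
    by (simp add: power_abs power_mult_distrib)
qed

definition sinc_pi :: "real \<Rightarrow> real" where
  "sinc_pi t = (if t = 0 then 1 else sin (pi * t) / (pi * t))"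

end

theory Submission
  imports Defs
begin

text \<open>
  On the Fourier side \<open>H\<close> is multiplication by \<open>\<i>x\<close> on \<open>(-\<pi>, \<pi>)\<close>, up to the choice of origin on the
  circle, so \<open>e\<^sup>t\<^sup>H\<close> is multiplication by \<open>e\<^sup>i\<^sup>t\<^sup>x\<close>.  Computing Fourier coefficients shows what its matrix
  should be: the entry in row \<open>m\<close>, column \<open>n\<close> is \<open>K\<^sub>t(m - n)\<close>, where
  \<open>K\<^sub>t(p) = (-1)\<^sup>p sinc(t + p)\<close>, that is \<open>sin(\<pi>t) / (\<pi>(t + p))\<close> when \<open>t + p \<noteq> 0\<close>.  For an integer \<open>k\<close>
  all but one of the \<open>K\<^sub>k(p)\<close> vanish, and \<open>e\<^sup>k\<^sup>H\<close> is \<open>(-1)\<^sup>k\<close> times the shift by \<open>k\<close>.  The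
  expansion then holds entry by entry.  On the diagonal both sides are \<open>sinc(t)\<close>.  Off the diagonal,
  with \<open>p = m - n \<noteq> 0\<close>, only \<open>H\<close> and the term with \<open>k = -p\<close> contribute, and what is needed is
  \<open>K\<^sub>t(p) = t sinc(t) / p - (t / p) K\<^sub>t(p)\<close>, which is the identity \<open>(t + p) K\<^sub>t(p) = t sinc(t)\<close>
  (\<open>exp_kernel_interpolation\<close>).  The series converges absolutely in \<open>l\<^sup>2\<close>, because the coefficients are
  products of two square-summable sequences and the operators \<open>e\<^sup>k\<^sup>H\<close> are isometries.
  
  The work lies in proving the matrix of \<open>e\<^sup>t\<^sup>H\<close>, and this is done without Fourier analysis.  The
  vectors \<open>r(x)\<^sub>j = c / (x + j)\<close> satisfy \<open>r' = -q\<close> and \<open>H r = \<pi> cot(\<pi>x) r - q\<close> with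
  \<open>q\<^sub>j = c / (x + j)\<^sup>2\<close>; the second equation is the partial fraction expansion of the cotangent
  (\<open>Hilb_recip\<close>).  Hence \<open>v(t) = sin(\<pi>t) / \<pi> r(t - n)\<close> solves \<open>v' = H v\<close> on \<open>(0, 1)\<close>, and \<open>v(t)\<close>
  tends to \<open>c\<close> times the \<open>n\<close>-th basis vector as \<open>t\<close> decreases to 0.  By uniqueness for linear
  differential equations \<open>v(t)\<close> is \<open>e\<^sup>t\<^sup>H\<close> applied to that vector.  Letting \<open>t\<close> tend to 1 shows that
  \<open>e\<^sup>H\<close> is minus the shift, and \<open>e\<^sup>(\<^sup>s\<^sup>+\<^sup>k\<^sup>)\<^sup>H = e\<^sup>s\<^sup>H e\<^sup>k\<^sup>H\<close> carries the formula to all real \<open>t\<close>.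
\<close>

section \<open>Partial fractions of the cotangent\<close>

text \<open>
  The logarithmic derivative of Euler's reflection formula \<open>\<Gamma>(z) \<Gamma>(1 - z) = \<pi> / sin(\<pi>z)\<close>.
\<close>

lemma Digamma_reflection_complex:
  fixes z :: complex
  assumes z: "z \<notin> \<int>"
  shows "Digamma z - Digamma (1 - z) = - of_real pi * cot (of_real pi * z)"
proof -
  have z': "1 - z \<notin> \<int>"
    using z by (metis Ints_1 Ints_diff add_diff_cancel_right' diff_add_cancel minus_diff_eq uminus_add_conv_diff)
  have np: "z \<notin> \<int>\<^sub>\<le>\<^sub>0" "1 - z \<notin> \<int>\<^sub>\<le>\<^sub>0"
    using z z' nonpos_Ints_Int by blast+
  let ?s = "sin (of_real pi * z)" and ?c = "cos (of_real pi * z)"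
  have s0: "?s \<noteq> 0"
  proof
    assume "?s = 0"
    then obtain n :: int where "of_real pi * z = of_real (n * pi)"
      by (auto simp: sin_eq_0)
    then have "z = of_int n" by (auto simp: mult.commute)
    then show False using z by simp
  qed
  have refl: "(\<lambda>z::complex. Gamma z * Gamma (1 - z)) = (\<lambda>z. of_real pi / sin (of_real pi * z))"
    by (rule ext) (rule Gamma_reflection_complex)
  have "((\<lambda>z::complex. Gamma z * Gamma (1 - z)) has_field_derivative
      Gamma z * Gamma (1 - z) * (Digamma z - Digamma (1 - z))) (at z)"
    using np by (auto intro!: derivative_eq_intros simp: algebra_simps)
  moreover have "((\<lambda>z. of_real pi / sin (of_real pi * z)) has_field_derivative
      of_real pi / ?s * (- of_real pi * cot (of_real pi * z))) (at z)"
    using s0 by (auto intro!: derivative_eq_intros simp: cot_def)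
  ultimately have "Gamma z * Gamma (1 - z) * (Digamma z - Digamma (1 - z))
      = of_real pi / ?s * (- of_real pi * cot (of_real pi * z))"
    unfolding refl by (rule DERIV_unique)
  moreover have "of_real pi / ?s \<noteq> 0"
    using s0 by simp
  ultimately show ?thesis
    unfolding Gamma_reflection_complex by (metis mult_left_cancel)
qed

text \<open>
  Inserting \<open>\<psi>(z) = lim (ln m - \<Sum>\<^sub>n\<^sub><\<^sub>m 1 / (z + n))\<close> into the reflection formula for \<open>\<psi>\<close> writes \<open>\<pi> cot(\<pi>x)\<close> as
  the sum of \<open>1 / (x + n) + 1 / (x - 1 - n)\<close>.  Pairing the poles at \<open>p\<close> and \<open>-p\<close> instead gives the
  terms \<open>2x / (x\<^sup>2 - p\<^sup>2)\<close>; a factor \<open>x\<close> is divided out because the remaining sum is the one that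
  occurs in \<open>H r\<close>.
\<close>

lemma cot_partial_fractions:
  fixes x :: real
  assumes x: "x \<notin> \<int>"
  shows "(\<lambda>N. \<Sum>p=1..N. 2 / (x\<^sup>2 - (real p)\<^sup>2)) \<longlonglongrightarrow> (pi * cot (pi * x) - 1 / x) / x"
proof -
  have x0: "x + of_int n \<noteq> 0" for n :: int
    using x by (metis Ints_minus Ints_of_int add_eq_0_iff2)
  define z where "z = complex_of_real x"
  have z: "z \<notin> \<int>"
    using x unfolding z_def by simp
  have "z \<noteq> 0" "1 - z \<noteq> 0" using z by (auto simp: z_def)
  then have "(\<lambda>m. (of_real (ln (real m)) - (\<Sum>n<m. inverse (z + of_nat n)))
      - (of_real (ln (real m)) - (\<Sum>n<m. inverse (1 - z + of_nat n))))
      \<longlonglongrightarrow> Digamma z - Digamma (1 - z)"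
    by (intro tendsto_diff Digamma_LIMSEQ)
  then have "(\<lambda>m. - (\<Sum>n<m. inverse (z + of_nat n) - inverse (1 - z + of_nat n)))
      \<longlonglongrightarrow> - of_real pi * cot (of_real pi * z)"
    unfolding Digamma_reflection_complex[OF z] by (simp add: sum_subtractf)
  moreover have inv: "inverse (z + of_nat n) - inverse (1 - z + of_nat n)
      = of_real (1 / (x + real n) + 1 / (x - 1 - real n))" for n
  proof -
    have "inverse (1 - z + of_nat n) = - (1 / (z - 1 - of_nat n))"
      by (simp add: minus_divide_right inverse_eq_divide)
    then show ?thesis by (simp add: z_def inverse_eq_divide)
  qed
  moreover have "of_real pi * cot (of_real pi * z) = complex_of_real (pi * cot (pi * x))"
    unfolding z_def cot_def of_real_mult[symmetric] cos_of_real sin_of_real by simp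
  ultimately have "(\<lambda>m. - of_real (\<Sum>n<m. 1 / (x + real n) + 1 / (x - 1 - real n)))
      \<longlonglongrightarrow> - complex_of_real (pi * cot (pi * x))"
    by (simp del: of_real_add of_real_divide of_real_diff of_real_mult)
  from tendsto_minus[OF this]
  have "(\<lambda>m. of_real (\<Sum>n<m. 1 / (x + real n) + 1 / (x - 1 - real n)))
      \<longlonglongrightarrow> complex_of_real (pi * cot (pi * x))"
    by simp
  then have lim: "(\<lambda>m. \<Sum>n<m. 1 / (x + real n) + 1 / (x - 1 - real n)) \<longlonglongrightarrow> pi * cot (pi * x)"
    by (simp only: tendsto_of_real_iff)
  \<comment> \<open>Regrouping: the pole at 0 is unpaired, and so is the last pole, at \<open>N + 1\<close>.\<close>
  have "(\<Sum>n<Suc N. 1 / (x + real n) + 1 / (x - 1 - real n)) - 1 / (x - 1 - real N) - 1 / x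
      = x * (\<Sum>p=1..N. 2 / (x\<^sup>2 - (real p)\<^sup>2))" for N
  proof (induction N)
    case (Suc N)
    have "x + real (Suc N) \<noteq> 0" "x - real (Suc N) \<noteq> 0"
      using x0[of "int (Suc N)"] x0[of "- int (Suc N)"] by simp_all
    then have "1 / (x + real (Suc N)) + 1 / (x - real (Suc N)) = x * (2 / (x\<^sup>2 - (real (Suc N))\<^sup>2))"
      unfolding square_diff_square_factored power2_eq_square by (simp add: add_frac_eq)
    then show ?case using Suc by (simp add: algebra_simps)
  qed simp
  moreover have "(\<lambda>N. (\<Sum>n<Suc N. 1 / (x + real n) + 1 / (x - 1 - real n)) - 1 / (x - 1 - real N) - 1 / x)
      \<longlonglongrightarrow> pi * cot (pi * x) - 0 - 1 / x"
  proof (intro tendsto_diff tendsto_const)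
    show "(\<lambda>N. \<Sum>n<Suc N. 1 / (x + real n) + 1 / (x - 1 - real n)) \<longlonglongrightarrow> pi * cot (pi * x)"
      using lim by (rule LIMSEQ_Suc)
    have "filterlim (\<lambda>N. - real N) at_bot sequentially"
      by (simp add: filterlim_uminus_at_bot filterlim_real_sequentially)
    then have "filterlim (\<lambda>N. x - 1 - real N) at_bot sequentially"
      using filterlim_tendsto_add_at_bot_iff[OF tendsto_const[of "x - 1"], of "\<lambda>N. - real N" sequentially]
      by simp
    then have "filterlim (\<lambda>N. x - 1 - real N) at_infinity sequentially"
      by (rule filterlim_mono) (auto intro: at_bot_le_at_infinity)
    then show "(\<lambda>N. 1 / (x - 1 - real N)) \<longlonglongrightarrow> 0"
      by (rule tendsto_divide_0[OF tendsto_const])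
  qed
  ultimately have "(\<lambda>N. x * (\<Sum>p=1..N. 2 / (x\<^sup>2 - (real p)\<^sup>2))) \<longlonglongrightarrow> pi * cot (pi * x) - 1 / x"
    by simp
  from tendsto_divide[OF this tendsto_const[of x]] show ?thesis
    using x0[of 0] by simp
qed

section \<open>The one-parameter group generated by the Hilbert transform\<close>

text \<open>
  Gronwall's argument: for the difference \<open>z\<close> of two solutions, \<open>e\<^sup>-\<^sup>2\<^sup>K\<^sup>t \<parallel>z(t)\<parallel>\<^sup>2\<close> with \<open>K = \<parallel>A\<parallel>\<close> is
  nonincreasing and vanishes at 0.  The equation is required on the open interval only, since the
  solution constructed below is known at 0 merely as a limit.
\<close>

lemma linear_ode_unique:
  fixes A :: "'a::real_inner \<Rightarrow>\<^sub>L 'a" and x y :: "real \<Rightarrow> 'a"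
  assumes cont: "continuous_on {0..b} x" "continuous_on {0..b} y"
    and x: "\<And>t. 0 < t \<Longrightarrow> t < b \<Longrightarrow> (x has_vector_derivative A (x t)) (at t)"
    and y: "\<And>t. 0 < t \<Longrightarrow> t < b \<Longrightarrow> (y has_vector_derivative A (y t)) (at t)"
    and init: "x 0 = y 0" and t: "0 \<le> t" "t \<le> b"
  shows "x t = y t"
proof -
  define K where "K = norm A"
  define z where "z t = x t - y t" for t
  define \<phi> where "\<phi> t = exp (- 2 * K * t) * (z t \<bullet> z t)" for t
  have "\<phi> t \<le> \<phi> 0"
  proof (rule DERIV_nonpos_imp_decreasing_open[OF \<open>0 \<le> t\<close>])
    fix s assume s: "0 < s" "s < t"
    have z': "(z has_derivative (\<lambda>h. h *\<^sub>R A (z s))) (at s)"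
      using has_vector_derivative_diff[OF x y, of s] s t
      unfolding z_def[abs_def] has_vector_derivative_def by (simp add: blinfun.diff_right)
    have "(\<phi> has_derivative (\<lambda>h. h * (2 * exp (- 2 * K * s) * (z s \<bullet> A (z s) - K * (z s \<bullet> z s))))) (at s)"
      unfolding \<phi>_def[abs_def]
      by (rule derivative_eq_intros z' refl)+
         (simp add: fun_eq_iff inner_commute algebra_simps)
    then have "(\<phi> has_real_derivative 2 * exp (- 2 * K * s) * (z s \<bullet> A (z s) - K * (z s \<bullet> z s))) (at s)"
      by (simp add: has_field_derivative_def mult_commute_abs)
    moreover have "z s \<bullet> A (z s) \<le> norm (z s) * norm (A (z s))"
      by (rule norm_cauchy_schwarz)
    moreover have "norm (z s) * norm (A (z s)) \<le> norm (z s) * (K * norm (z s))"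
      unfolding K_def by (intro mult_left_mono norm_blinfun) auto
    moreover have "norm (z s) * (K * norm (z s)) = K * (z s \<bullet> z s)"
      by (simp add: dot_square_norm power2_eq_square)
    ultimately show "\<exists>d. (\<phi> has_real_derivative d) (at s) \<and> d \<le> 0"
      by (intro exI conjI) (auto intro!: mult_nonneg_nonpos)
  next
    show "continuous_on {0..t} \<phi>"
      unfolding \<phi>_def[abs_def] z_def[abs_def]
      by (intro continuous_intros continuous_on_subset[OF cont(1)] continuous_on_subset[OF cont(2)])
         (use t in auto)
  qed
  also have "\<phi> 0 = 0"
    by (simp add: \<phi>_def z_def init)
  finally have "z t \<bullet> z t \<le> 0"
    by (simp add: \<phi>_def mult_le_0_iff not_le[symmetric])
  then have "z t \<bullet> z t = 0"
    using inner_ge_zero[of "z t"] by linarith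
  then show ?thesis
    by (simp add: z_def)
qed

text \<open>
  Differentiating the power series term by term shifts it by one place and leaves a factor \<open>H\<close>; both
  series converge uniformly on bounded sets of \<open>t\<close>.
\<close>

lemma exp_Hilb_has_vector_derivative:
  "(exp_Hilb has_vector_derivative (Hilb o\<^sub>L exp_Hilb t)) (at t)"
proof -
  define R where "R = \<bar>t\<bar> + 1"
  define S where "S = ball (0::real) R"
  define P where "P n x = (x ^ n / fact n) *\<^sub>R blinfun_pow Hilb n" for n and x :: real
  define P' where "P' n x = (of_nat n * x ^ (n - 1) / fact n) *\<^sub>R blinfun_pow Hilb n" for n and x :: real
  have R: "0 \<le> R" by (simp add: R_def)
  have t: "t \<in> S" by (simp add: S_def R_def)
  have "open S" by (simp add: S_def)
  have unif: "uniform_limit S (\<lambda>n x. \<Sum>i<n. P i x) exp_Hilb sequentially"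
    unfolding exp_Hilb_def[abs_def] P_def
  proof (rule Weierstrass_m_test)
    show "summable (\<lambda>k. (R * norm Hilb) ^ k / fact k)"
      using summable_exp_generic[of "R * norm Hilb"] by (simp add: field_simps)
    show "norm ((x ^ k / fact k) *\<^sub>R blinfun_pow Hilb k) \<le> (R * norm Hilb) ^ k / fact k"
      if "x \<in> S" for k x
    proof -
      have "\<bar>x\<bar> ^ k * norm (blinfun_pow Hilb k) \<le> R ^ k * norm Hilb ^ k"
        using that R by (intro mult_mono power_mono norm_blinfun_pow_le) (auto simp: S_def)
      then show ?thesis
        by (simp add: power_abs power_mult_distrib divide_right_mono)
    qed
  qed
  have shift: "(\<Sum>i<Suc n. P' i x) = Hilb o\<^sub>L (\<Sum>i<n. P i x)" for n x
  proof -
    have "(\<Sum>i<Suc n. P' i x) = (\<Sum>i<n. P' (Suc i) x)"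
      by (simp add: sum.lessThan_Suc_shift P'_def del: sum.lessThan_Suc)
    also have "\<dots> = (\<Sum>i<n. Hilb o\<^sub>L P i x)"
    proof (rule sum.cong)
      fix i
      have "of_nat (Suc i) * x ^ i / fact (Suc i) = x ^ i / fact i"
        by (simp add: divide_simps)
      then show "P' (Suc i) x = Hilb o\<^sub>L P i x"
        by (simp add: P'_def P_def bounded_bilinear.scaleR_right[OF bounded_bilinear_blinfun_compose])
    qed simp
    finally show ?thesis by (simp add: bounded_bilinear.sum_right[OF bounded_bilinear_blinfun_compose])
  qed
  have "\<exists>g. \<forall>x\<in>S. (\<lambda>n. P n x) sums g x \<and>
      (g has_derivative (\<lambda>h. h *\<^sub>R (Hilb o\<^sub>L exp_Hilb x))) (at x within S)"
  proof (rule has_derivative_series)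
    show "convex S" by (simp add: S_def)
    show "t \<in> S" by (rule t)
    show "(\<lambda>n. P n t) sums exp_Hilb t"
      unfolding P_def exp_Hilb_def by (rule summable_sums[OF summable_exp_Hilb])
    show "(P n has_derivative (\<lambda>h. h *\<^sub>R P' n x)) (at x within S)" for n x
      unfolding P_def[abs_def] P'_def
    proof -
      have "((\<lambda>x. x ^ n / fact n) has_derivative (\<lambda>h. h * (of_nat n * x ^ (n - 1) / fact n))) (at x within S)"
        by (rule has_derivative_eq_rhs[OF DERIV_cdivide[OF DERIV_pow[of n x S], of "fact n",
              unfolded has_field_derivative_def]]) (simp add: fun_eq_iff)
      from has_derivative_scaleR_left[OF this, of "blinfun_pow Hilb n"]
      show "((\<lambda>x. (x ^ n / fact n) *\<^sub>R blinfun_pow Hilb n) has_derivative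
          (\<lambda>h. h *\<^sub>R ((of_nat n * x ^ (n - 1) / fact n) *\<^sub>R blinfun_pow Hilb n))) (at x within S)"
        by simp
    qed
    show "\<forall>\<^sub>F n in sequentially. \<forall>x\<in>S. \<forall>h. norm ((\<Sum>i<n. h *\<^sub>R P' i x)
        - h *\<^sub>R (Hilb o\<^sub>L exp_Hilb x)) \<le> e * norm h" if "0 < e" for e
    proof -
      have "0 < e / (norm Hilb + 1)"
        using that by (simp add: add_nonneg_pos)
      from uniform_limitD[OF unif this]
      have "\<forall>\<^sub>F n in sequentially. \<forall>x\<in>S. dist (\<Sum>i<n. P i x) (exp_Hilb x) < e / (norm Hilb + 1)" .
      then have "\<forall>\<^sub>F n in sequentially. \<forall>x\<in>S. \<forall>h. norm ((\<Sum>i<Suc n. h *\<^sub>R P' i x)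
          - h *\<^sub>R (Hilb o\<^sub>L exp_Hilb x)) \<le> e * norm h"
      proof eventually_elim
        case (elim n)
        show ?case
        proof (intro ballI allI)
          fix x h assume "x \<in> S"
          let ?d = "(\<Sum>i<n. P i x) - exp_Hilb x"
          have "norm (Hilb o\<^sub>L ?d) \<le> norm Hilb * norm ?d"
            by (rule norm_blinfun_compose)
          also have "\<dots> \<le> (norm Hilb + 1) * (e / (norm Hilb + 1))"
            using elim \<open>x \<in> S\<close> by (intro mult_mono) (auto simp: dist_norm less_imp_le)
          also have "\<dots> = e"
          proof -
            have "norm Hilb + 1 \<noteq> 0" using norm_ge_zero[of Hilb] by linarith
            then show ?thesis by simp
          qed
          finally have "norm (Hilb o\<^sub>L ?d) \<le> e" .
          from mult_left_mono[OF this abs_ge_zero[of h]]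
          have "norm (h *\<^sub>R (Hilb o\<^sub>L ?d)) \<le> e * norm h"
            by (simp add: mult.commute)
          moreover have "(\<Sum>i<Suc n. h *\<^sub>R P' i x) - h *\<^sub>R (Hilb o\<^sub>L exp_Hilb x) = h *\<^sub>R (Hilb o\<^sub>L ?d)"
            unfolding scaleR_right.sum[symmetric] shift
            by (simp add: bounded_bilinear.diff_right[OF bounded_bilinear_blinfun_compose] scaleR_diff_right)
          ultimately show "norm ((\<Sum>i<Suc n. h *\<^sub>R P' i x) - h *\<^sub>R (Hilb o\<^sub>L exp_Hilb x)) \<le> e * norm h"
            by metis
        qed
      qed
      then show ?thesis by (subst eventually_sequentially_Suc[symmetric])
    qed
  qed
  then obtain g where g: "\<And>x. x \<in> S \<Longrightarrow> (\<lambda>n. P n x) sums g x"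
    "(g has_derivative (\<lambda>h. h *\<^sub>R (Hilb o\<^sub>L exp_Hilb t))) (at t within S)"
    using t by blast
  have "(g has_derivative (\<lambda>h. h *\<^sub>R (Hilb o\<^sub>L exp_Hilb t))) (at t)"
    using g(2) at_within_open[OF t \<open>open S\<close>] by simp
  then have "(exp_Hilb has_derivative (\<lambda>h. h *\<^sub>R (Hilb o\<^sub>L exp_Hilb t))) (at t)"
  proof (rule has_derivative_transform_within_open)
    show "open S" by fact
    show "g x = exp_Hilb x" if "x \<in> S" for x
      using sums_unique[OF g(1)[OF that]] by (simp add: exp_Hilb_def P_def)
  qed (rule t)
  then show ?thesis by (simp add: has_vector_derivative_def)
qed

lemma exp_Hilb_apply_has_vector_derivative:
  "((\<lambda>t. exp_Hilb t a) has_vector_derivative Hilb (exp_Hilb t a)) (at t)"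
  using bounded_linear.has_vector_derivative[OF blinfun.bounded_linear_left exp_Hilb_has_vector_derivative]
  by simp

lemma continuous_on_exp_Hilb_apply: "continuous_on S (\<lambda>t. exp_Hilb t a)"
  by (intro continuous_at_imp_continuous_on ballI
      has_vector_derivative_continuous[OF exp_Hilb_apply_has_vector_derivative])

lemma exp_Hilb_0 [simp]: "exp_Hilb 0 = id_blinfun"
proof -
  have "exp_Hilb 0 = (\<Sum>k\<in>{0}. (0 ^ k / fact k) *\<^sub>R blinfun_pow Hilb k)"
    unfolding exp_Hilb_def by (rule suminf_finite) (auto simp: power_0_left)
  then show ?thesis by simp
qed

text \<open>
  Both sides, as functions of \<open>s\<close>, solve \<open>x' = H x\<close> with initial value \<open>e\<^sup>t\<^sup>H a\<close>.  As \<open>t\<close> is arbitrary,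
  the forward case \<open>s \<ge> 0\<close> also gives the inverses \<open>e\<^sup>-\<^sup>k\<^sup>H\<close>.
\<close>

lemma exp_Hilb_add:
  assumes "0 \<le> s"
  shows "exp_Hilb (s + t) a = exp_Hilb s (exp_Hilb t a)"
proof (rule linear_ode_unique[where b = s and t = s and A = Hilb
      and x = "\<lambda>u. exp_Hilb (u + t) a" and y = "\<lambda>u. exp_Hilb u (exp_Hilb t a)"])
  show "continuous_on {0..s} (\<lambda>u. exp_Hilb (u + t) a)"
    by (rule continuous_on_compose2[OF continuous_on_exp_Hilb_apply[of UNIV]])
       (auto intro!: continuous_intros)
  show "((\<lambda>u. exp_Hilb (u + t) a) has_vector_derivative Hilb (exp_Hilb (u + t) a)) (at u)" for u
  proof -
    have "((\<lambda>u. u + t) has_vector_derivative 1) (at u)"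
      by (auto intro!: derivative_eq_intros)
    from vector_diff_chain_at[OF this exp_Hilb_apply_has_vector_derivative[of a]]
    show ?thesis by (simp add: o_def)
  qed
qed (use assms in \<open>auto intro: continuous_on_exp_Hilb_apply exp_Hilb_apply_has_vector_derivative\<close>)

section \<open>Basis vectors\<close>

lemma bounded_linear_ell2_nth: "bounded_linear (\<lambda>a. ell2_nth a j)"
  by (rule bounded_linear_intro[where K = 1]) (simp_all add: cmod_ell2_nth_le)

lemma square_summable_comparison:
  assumes "\<And>j. cmod (f j) \<le> C * cmod (ell2_nth b j)"
  shows "square_summable f"
  unfolding square_summable_def
proof (rule summable_on_comparison_test)
  show "(\<lambda>j. C\<^sup>2 * (cmod (ell2_nth b j))\<^sup>2) summable_on UNIV"
    by (intro summable_on_cmult_right summable_on_ell2)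
  show "(cmod (f j))\<^sup>2 \<le> C\<^sup>2 * (cmod (ell2_nth b j))\<^sup>2" for j
    using power_mono[OF assms, of j 2] by (simp add: power_mult_distrib)
qed simp

lemma norm_ell2_comparison:
  assumes "\<And>j. cmod (ell2_nth a j) \<le> C * cmod (ell2_nth b j)" and "0 \<le> C"
  shows "norm a \<le> C * norm b"
proof (rule power2_le_imp_le)
  have "(norm a)\<^sup>2 \<le> (\<Sum>\<^sub>\<infinity>j. C\<^sup>2 * (cmod (ell2_nth b j))\<^sup>2)"
    unfolding norm_ell2_sq
  proof (rule infsum_mono)
    show "(cmod (ell2_nth a j))\<^sup>2 \<le> C\<^sup>2 * (cmod (ell2_nth b j))\<^sup>2" for j
      using power_mono[OF assms(1), of j 2] by (simp add: power_mult_distrib)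
  qed (intro summable_on_ell2 summable_on_cmult_right)+
  also have "\<dots> = (C * norm b)\<^sup>2"
    by (simp add: infsum_cmult_right' norm_ell2_sq power_mult_distrib)
  finally show "(norm a)\<^sup>2 \<le> (C * norm b)\<^sup>2" .
qed (use assms(2) in simp)

lift_definition single :: "complex \<Rightarrow> int \<Rightarrow> ell2" is "\<lambda>c n j. if j = n then c else 0"
proof (rule square_summable_bounded(1))
  fix c :: complex and n :: int and F :: "int set" assume F: "finite F"
  have "(\<Sum>j\<in>F. (cmod (if j = n then c else 0))\<^sup>2) = (\<Sum>j\<in>F. if j = n then (cmod c)\<^sup>2 else 0)"
    by (intro sum.cong) auto
  also have "\<dots> \<le> (cmod c)\<^sup>2"
    using F by simp
  finally show "(\<Sum>j\<in>F. (cmod (if j = n then c else 0))\<^sup>2) \<le> (cmod c)\<^sup>2" .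
qed

text \<open>
  Expansion in the standard basis, so that a bounded operator is determined by its values on the
  vectors \<open>single c n\<close>.  The type carries real scalars only, hence the complex coefficient \<open>c\<close> is an
  argument of the basis vector.
\<close>

lemma has_sum_single: "((\<lambda>n. single (ell2_nth a n) n) has_sum a) UNIV"
proof -
  define s where "s = (\<lambda>n. (cmod (ell2_nth a n))\<^sup>2)"
  have coord: "ell2_nth (\<Sum>n\<in>F. single (ell2_nth a n) n) j = (if j \<in> F then ell2_nth a j else 0)"
    if "finite F" for F j
    using that by (induction F) (auto simp: single.rep_eq)
  have dist: "norm ((\<Sum>n\<in>F. single (ell2_nth a n) n) - a) = sqrt (infsum s UNIV - sum s F)"
    if F: "finite F" for F
  proof -
    have "infsum s UNIV - sum s F = infsum s (UNIV - F)"
      using infsum_Diff[of s UNIV F] F summable_on_ell2 by (simp add: s_def)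
    also have "\<dots> = (\<Sum>\<^sub>\<infinity>j. (cmod (ell2_nth ((\<Sum>n\<in>F. single (ell2_nth a n) n) - a) j))\<^sup>2)"
      by (rule infsum_cong_neutral) (auto simp: s_def coord[OF F])
    finally show ?thesis by (simp add: norm_ell2_def)
  qed
  have "(sum s \<longlongrightarrow> infsum s UNIV) (finite_subsets_at_top UNIV)"
    unfolding s_def by (rule infsum_tendsto[OF summable_on_ell2])
  from tendsto_real_sqrt[OF tendsto_diff[OF tendsto_const[of "infsum s UNIV"] this]]
  have "((\<lambda>F. sqrt (infsum s UNIV - sum s F)) \<longlongrightarrow> 0) (finite_subsets_at_top UNIV)"
    by simp
  then have "((\<lambda>F. norm ((\<Sum>n\<in>F. single (ell2_nth a n) n) - a)) \<longlongrightarrow> 0) (finite_subsets_at_top UNIV)"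
    by (rule Lim_transform_eventually)
       (auto intro!: eventually_finite_subsets_at_top_weakI simp: dist)
  then show ?thesis
    unfolding has_sum_def tendsto_norm_zero_iff using Lim_null by blast
qed

lemma has_sum_apply_single:
  "((\<lambda>n. ell2_nth (blinfun_apply B (single (ell2_nth a n) n)) m) has_sum ell2_nth (blinfun_apply B a) m) UNIV"
  by (rule has_sum_bounded_linear[OF bounded_linear_compose[OF bounded_linear_ell2_nth
        blinfun.bounded_linear_right] has_sum_single])

lemma ell2_nth_Hilb_single: "ell2_nth (Hilb (single c n)) m = c / of_int (m - n)"
proof (cases "m = n")
  case True
  then show ?thesis
    unfolding ell2_nth_Hilb by (auto simp: single.rep_eq intro!: infsum_0)
next
  case False
  have "((\<lambda>l. ell2_nth (single c n) l / of_int (m - l)) has_sum c / of_int (m - n)) (UNIV - {m})"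
    by (rule has_sum_finite_neutralI[of "{n}"]) (use False in \<open>auto simp: single.rep_eq\<close>)
  then show ?thesis
    unfolding ell2_nth_Hilb by (rule infsumI)
qed

section \<open>The Hilbert transform of \<open>1 / (x + j)\<close>\<close>

text \<open>
  Real numbers congruent to \<open>x\<close> modulo 1 cannot accumulate at 0.  Excluding the value 0 itself makes
  this true for integer \<open>x\<close> as well.
\<close>

lemma integer_translates_bounded_below:
  fixes x :: real
  obtains \<delta> where "0 < \<delta>" "\<And>j::int. x + of_int j \<noteq> 0 \<Longrightarrow> \<delta> \<le> \<bar>x + of_int j\<bar>"
proof
  define f where "f = frac x"
  define \<delta> where "\<delta> = (if f = 0 then 1 else min f (1 - f))"
  have f: "0 \<le> f" "f < 1" by (simp_all add: f_def frac_lt_1)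
  show "0 < \<delta>" using f by (simp add: \<delta>_def)
  show "\<delta> \<le> \<bar>x + of_int j\<bar>" if "x + of_int j \<noteq> 0" for j
  proof -
    define m where "m = \<lfloor>x\<rfloor> + j"
    have x: "x + of_int j = of_int m + f" by (simp add: m_def f_def frac_def)
    consider "m \<ge> 1" | "m = 0" | "m \<le> -1" by linarith
    then show ?thesis
    proof cases
      case 1
      then have "real_of_int m \<ge> 1" by simp
      then show ?thesis using f unfolding x \<delta>_def by (auto simp: min_def)
    next
      case 2
      then show ?thesis using f that unfolding x \<delta>_def by (auto simp: min_def)
    next
      case 3
      then have "real_of_int m \<le> -1" by linarith
      then show ?thesis using f unfolding x \<delta>_def by (auto simp: min_def)
    qed
  qed
qed

text \<open>
  The coordinates are comparable to \<open>c / j\<close>, and \<open>c / j\<close> is the \<open>j\<close>-th coordinate of \<open>H\<close> applied to the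
  basis vector at 0, so that square summability comes for free.  At a pole \<open>x = -j\<close> the coordinate is 0
  by the convention for division.
\<close>

lift_definition recip :: "complex \<Rightarrow> real \<Rightarrow> ell2" is "\<lambda>c x j. c / of_real (x + of_int j)"
proof -
  fix c :: complex and x :: real
  obtain \<delta> where \<delta>: "0 < \<delta>" "\<And>j::int. x + of_int j \<noteq> 0 \<Longrightarrow> \<delta> \<le> \<bar>x + of_int j\<bar>"
    by (rule integer_translates_bounded_below[of x]) blast
  let ?b = "single c 0 + Hilb (single c 0)"
  show "square_summable (\<lambda>j. c / complex_of_real (x + of_int j))"
  proof (rule square_summable_comparison[where b = ?b and C = "1 + (\<bar>x\<bar> + 1) / \<delta>"])
    fix j :: int
    show "cmod (c / complex_of_real (x + of_int j)) \<le> (1 + (\<bar>x\<bar> + 1) / \<delta>) * cmod (ell2_nth ?b j)"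
    proof (cases "x + of_int j = 0")
      case False
      define y where "y = \<bar>x + real_of_int j\<bar>"
      define d where "d = (if j = 0 then 1 else \<bar>real_of_int j\<bar>)"
      have y: "\<delta> \<le> y" "0 < y" using \<delta>(2)[OF False] \<delta>(1) by (auto simp: y_def)
      \<comment> \<open>\<open>\<bar>j\<bar> \<le> \<bar>x + j\<bar> + \<bar>x\<bar>\<close>; the additional 1 covers \<open>j = 0\<close>.\<close>
      have "d \<le> y + (\<bar>x\<bar> + 1)" by (auto simp: y_def d_def)
      also have "\<bar>x\<bar> + 1 \<le> (\<bar>x\<bar> + 1) / \<delta> * y"
        using y \<delta>(1) mult_left_mono[OF y(1), of "\<bar>x\<bar> + 1"] by (simp add: field_simps)
      finally have "d \<le> (1 + (\<bar>x\<bar> + 1) / \<delta>) * y" by (simp add: algebra_simps)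
      moreover have "0 < d" by (auto simp: d_def)
      ultimately have "1 / y \<le> (1 + (\<bar>x\<bar> + 1) / \<delta>) * (1 / d)"
        using y by (simp add: field_simps)
      from mult_left_mono[OF this norm_ge_zero[of c]]
      have "cmod c / y \<le> (1 + (\<bar>x\<bar> + 1) / \<delta>) * (cmod c / d)"
        by (simp add: mult_ac)
      moreover have "cmod (ell2_nth ?b j) = cmod c / d"
        by (auto simp: single.rep_eq ell2_nth_Hilb_single d_def norm_divide)
      moreover have "cmod (c / complex_of_real (x + of_int j)) = cmod c / y"
        unfolding y_def norm_divide norm_of_real ..
      ultimately show ?thesis by simp
    qed (use \<delta>(1) in simp)
  qed
qed

lift_definition recip_sq :: "complex \<Rightarrow> real \<Rightarrow> ell2" is "\<lambda>c x j. c / (of_real (x + of_int j))\<^sup>2"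
proof -
  fix c :: complex and x :: real
  obtain \<delta> where \<delta>: "0 < \<delta>" "\<And>j::int. x + of_int j \<noteq> 0 \<Longrightarrow> \<delta> \<le> \<bar>x + of_int j\<bar>"
    by (rule integer_translates_bounded_below[of x]) blast
  show "square_summable (\<lambda>j. c / (complex_of_real (x + of_int j))\<^sup>2)"
  proof (rule square_summable_comparison[where b = "recip c x" and C = "1 / \<delta>"])
    fix j :: int
    show "cmod (c / (complex_of_real (x + of_int j))\<^sup>2) \<le> 1 / \<delta> * cmod (ell2_nth (recip c x) j)"
    proof (cases "x + of_int j = 0")
      case False
      have "1 / \<bar>x + of_int j\<bar> \<le> 1 / \<delta>"
        using \<delta>(1) \<delta>(2)[OF False] by (simp add: frac_le)
      from mult_right_mono[OF this, of "cmod c / \<bar>x + of_int j\<bar>"]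
      show ?thesis
        unfolding recip.rep_eq norm_divide norm_power norm_of_real by (simp add: power2_eq_square)
    qed (use \<delta>(1) in simp)
  qed
qed

lemma not_Ints_plus_int:
  fixes x :: real assumes "x \<notin> \<int>" shows "x + of_int j \<noteq> 0"
  using assms by (metis Ints_minus Ints_of_int add_eq_0_iff2)

text \<open>
  Put \<open>y = x + j\<close>.  In the series for the \<open>j\<close>-th coordinate the terms with indices \<open>j + p\<close> and
  \<open>j - p\<close> add up to \<open>2c / (y\<^sup>2 - p\<^sup>2)\<close>, which is the cotangent series at \<open>y\<close>, and \<open>cot(\<pi>y) = cot(\<pi>x)\<close>.
  The unordered sum exists, so it may be computed along the symmetric index sets \<open>X N\<close>.
\<close>

lemma Hilb_recip:
  assumes x: "x \<notin> \<int>"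
  shows "Hilb (recip c x) = (pi * cot (pi * x)) *\<^sub>R recip c x - recip_sq c x"
proof (rule ell2_eqI)
  fix j :: int
  define g where "g l = ell2_nth (recip c x) l / of_int (j - l)" for l
  define y where "y = x + of_int j"
  define X where "X N = (\<lambda>p. j + int p) ` {1..N} \<union> (\<lambda>p. j - int p) ` {1..N}" for N
  have y0: "y + of_int p \<noteq> 0" for p :: int
    using not_Ints_plus_int[OF x, of "j + p"] by (simp add: y_def algebra_simps)
  have lim: "(sum g \<longlongrightarrow> ell2_nth (Hilb (recip c x)) j) (finite_subsets_at_top (UNIV - {j}))"
    unfolding ell2_nth_Hilb g_def[abs_def] by (rule infsum_tendsto[OF summable_on_hilbert])
  have X: "filterlim X (finite_subsets_at_top (UNIV - {j})) sequentially"
    unfolding filterlim_finite_subsets_at_top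
  proof (intro allI impI)
    fix Y assume Y: "finite Y \<and> Y \<subseteq> UNIV - {j}"
    define M where "M = Max (insert 0 ((\<lambda>l. nat \<bar>l - j\<bar>) ` Y))"
    have M: "nat \<bar>l - j\<bar> \<le> M" if "l \<in> Y" for l
      unfolding M_def using Y that by (intro Max_ge) auto
    show "\<forall>\<^sub>F N in sequentially. finite (X N) \<and> Y \<subseteq> X N \<and> X N \<subseteq> UNIV - {j}"
    proof (rule eventually_sequentiallyI[of M], intro conjI)
      fix N assume N: "M \<le> N"
      show "Y \<subseteq> X N"
      proof
        fix l assume l: "l \<in> Y"
        then have "nat \<bar>l - j\<bar> \<in> {1..N}" using M[OF l] N Y by auto
        moreover have "l = j + int (nat \<bar>l - j\<bar>) \<or> l = j - int (nat \<bar>l - j\<bar>)" by auto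
        ultimately show "l \<in> X N" unfolding X_def by blast
      qed
    qed (auto simp: X_def)
  qed
  have sumX: "sum g (X N) = c * of_real (\<Sum>p=1..N. 2 / (y\<^sup>2 - (real p)\<^sup>2))" for N
  proof -
    have "sum g (X N) = (\<Sum>p=1..N. g (j + int p)) + (\<Sum>p=1..N. g (j - int p))"
      unfolding X_def by (subst sum.union_disjoint) (auto simp: sum.reindex inj_on_def)
    also have "\<dots> = (\<Sum>p=1..N. c * of_real (2 / (y\<^sup>2 - (real p)\<^sup>2)))"
      unfolding sum.distrib[symmetric]
    proof (rule sum.cong)
      fix p assume p: "p \<in> {1..N}"
      have nz: "y + real p \<noteq> 0" "y - real p \<noteq> 0" "real p \<noteq> 0"
        using y0[of "int p"] y0[of "- int p"] p by auto
      have "g (j + int p) + g (j - int p) = c * of_real (1 / (y - real p) / real p - 1 / (y + real p) / real p)"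
        by (simp add: g_def recip.rep_eq y_def algebra_simps)
      also have "1 / (y - real p) / real p - 1 / (y + real p) / real p = 2 / (y\<^sup>2 - (real p)\<^sup>2)"
      proof -
        have "1 / (y - real p) - 1 / (y + real p) = real p * (2 / (y\<^sup>2 - (real p)\<^sup>2))"
          unfolding square_diff_square_factored power2_eq_square
          using nz by (simp add: diff_frac_eq mult.commute)
        then show ?thesis
          unfolding diff_divide_distrib[symmetric] using nz by simp
      qed
      finally show "g (j + int p) + g (j - int p) = c * of_real (2 / (y\<^sup>2 - (real p)\<^sup>2))" .
    qed simp
    finally show ?thesis by (simp add: sum_distrib_left)
  qed
  have "y \<notin> \<int>" using x by (simp add: y_def)
  from tendsto_mult_left[OF tendsto_of_real[OF cot_partial_fractions[OF this]], of c]
  have "(\<lambda>N. sum g (X N)) \<longlonglongrightarrow> c * of_real ((pi * cot (pi * y) - 1 / y) / y)"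
    unfolding sumX .
  then have "ell2_nth (Hilb (recip c x)) j = c * of_real ((pi * cot (pi * y) - 1 / y) / y)"
    using filterlim_compose[OF lim X] LIMSEQ_unique by blast
  also have "cot (pi * y) = cot (pi * x)"
    by (simp add: y_def cot_def distrib_left cos_add sin_add)
  also have "c * of_real ((pi * cot (pi * x) - 1 / y) / y)
      = of_real (pi * cot (pi * x)) * (c / of_real y) - c / (of_real y)\<^sup>2"
    using y0[of 0] by (simp add: field_simps power2_eq_square)
  finally show "ell2_nth (Hilb (recip c x)) j
      = ell2_nth ((pi * cot (pi * x)) *\<^sub>R recip c x - recip_sq c x) j"
    by (simp add: recip.rep_eq recip_sq.rep_eq y_def scaleR_conv_of_real)
qed

text \<open>
  With \<open>y = x + j\<close>, the remainder in the \<open>j\<close>-th coordinate is exactly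
  \<open>h\<^sup>2 / ((y + h) y)\<close> times \<open>c / y\<close>.  If \<open>\<delta>\<close> bounds all \<open>\<bar>y\<bar>\<close> from below and \<open>\<bar>h\<bar> < \<delta> / 2\<close>, the first
  factor is at most \<open>2h\<^sup>2 / \<delta>\<^sup>2\<close> in modulus for all \<open>j\<close> at once, hence the remainder is \<open>O(h\<^sup>2)\<close> in norm.
\<close>

lemma recip_has_vector_derivative:
  assumes x: "x \<notin> \<int>"
  shows "(recip c has_vector_derivative - recip_sq c x) (at x)"
proof -
  obtain \<delta> where \<delta>: "0 < \<delta>" "\<And>j::int. \<delta> \<le> \<bar>x + of_int j\<bar>"
    using integer_translates_bounded_below[of x] not_Ints_plus_int[OF x] by metis
  define K where "K = 2 / \<delta>\<^sup>2 * norm (recip c x)"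
  have bound: "norm (recip c (x + h) - recip c x - h *\<^sub>R (- recip_sq c x)) \<le> K * h\<^sup>2"
    if h: "\<bar>h\<bar> < \<delta> / 2" for h
  proof -
    have "norm (recip c (x + h) - recip c x - h *\<^sub>R (- recip_sq c x)) \<le> (h\<^sup>2 * (2 / \<delta>\<^sup>2)) * norm (recip c x)"
    proof (rule norm_ell2_comparison)
      fix j :: int
      define y where "y = x + of_int j"
      have y: "\<delta> \<le> \<bar>y\<bar>" using \<delta>(2) by (simp add: y_def)
      have yh: "\<delta> / 2 \<le> \<bar>y + h\<bar>" using y h by linarith
      have nz: "y \<noteq> 0" "y + h \<noteq> 0" using y yh \<delta>(1) by auto
      have "1 / (y + h) - 1 / y + h / y\<^sup>2 = h\<^sup>2 / ((y + h) * y) * (1 / y)"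
        using nz by (simp add: divide_simps power2_eq_square) (simp add: algebra_simps)
      moreover have "ell2_nth (recip c (x + h) - recip c x - h *\<^sub>R (- recip_sq c x)) j
          = of_real (1 / (y + h) - 1 / y + h / y\<^sup>2) * c"
        by (simp add: recip.rep_eq recip_sq.rep_eq y_def scaleR_conv_of_real algebra_simps)
      ultimately have "ell2_nth (recip c (x + h) - recip c x - h *\<^sub>R (- recip_sq c x)) j
          = of_real (h\<^sup>2 / ((y + h) * y)) * ell2_nth (recip c x) j"
        by (simp only: recip.rep_eq y_def of_real_mult of_real_divide of_real_1) simp
      moreover have "\<bar>h\<^sup>2 / ((y + h) * y)\<bar> \<le> h\<^sup>2 * (2 / \<delta>\<^sup>2)"
      proof -
        have "\<delta> / 2 * \<delta> \<le> \<bar>y + h\<bar> * \<bar>y\<bar>"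
          using y yh \<delta>(1) by (intro mult_mono) auto
        then have "h\<^sup>2 / \<bar>(y + h) * y\<bar> \<le> h\<^sup>2 / (\<delta> / 2 * \<delta>)"
          using \<delta>(1) nz by (intro divide_left_mono mult_pos_pos) (auto simp: abs_mult)
        then show ?thesis by (simp add: power2_eq_square abs_mult)
      qed
      ultimately show "cmod (ell2_nth (recip c (x + h) - recip c x - h *\<^sub>R (- recip_sq c x)) j)
          \<le> h\<^sup>2 * (2 / \<delta>\<^sup>2) * cmod (ell2_nth (recip c x) j)"
        by (simp only: norm_mult norm_of_real mult_right_mono[OF _ norm_ge_zero])
    qed simp
    then show ?thesis by (simp add: K_def mult_ac)
  qed
  have "(\<lambda>h. norm (recip c (x + h) - recip c x - h *\<^sub>R (- recip_sq c x)) / norm h) \<midarrow>0\<rightarrow> 0"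
  proof (rule Lim_null_comparison)
    show "\<forall>\<^sub>F h in at 0. norm (norm (recip c (x + h) - recip c x - h *\<^sub>R (- recip_sq c x)) / norm h) \<le> K * \<bar>h\<bar>"
      unfolding eventually_at
    proof (intro exI conjI ballI impI)
      show "0 < \<delta> / 2" using \<delta>(1) by simp
      fix h :: real assume "h \<noteq> 0 \<and> dist h 0 < \<delta> / 2"
      then have "norm (recip c (x + h) - recip c x - h *\<^sub>R (- recip_sq c x)) / \<bar>h\<bar> \<le> K * h\<^sup>2 / \<bar>h\<bar>"
        by (intro divide_right_mono bound) auto
      also have "\<dots> = K * \<bar>h\<bar>"
        by (simp add: power2_eq_square abs_if)
      finally show "norm (norm (recip c (x + h) - recip c x - h *\<^sub>R (- recip_sq c x)) / norm h) \<le> K * \<bar>h\<bar>"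
        by simp
    qed
    show "(\<lambda>h. K * \<bar>h\<bar>) \<midarrow>0\<rightarrow> 0"
      by (rule tendsto_eq_intros refl | simp)+
  qed
  then show ?thesis
    unfolding has_vector_derivative_def has_derivative_at by (intro conjI bounded_linear_scaleR_left)
qed

section \<open>The matrix of the exponential\<close>

lemma mult_sinc_pi: "x * sinc_pi x = sin (pi * x) / pi"
  by (simp add: sinc_pi_def)

lemma sinc_pi_minus: "sinc_pi (- x) = sinc_pi x"
  by (simp add: sinc_pi_def)

lemma sinc_pi_of_int: "sinc_pi (of_int k) = (if k = 0 then 1 else 0)"
  by (simp add: sinc_pi_def)

lemma isCont_sinc_pi: "isCont sinc_pi x"
proof (cases "x = 0")
  case True
  have "((\<lambda>t. sin (pi * t)) has_real_derivative pi) (at 0)"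
    by (auto intro!: derivative_eq_intros)
  then have "(\<lambda>t. sin (pi * t) / t) \<midarrow>0\<rightarrow> pi"
    by (simp add: DERIV_def)
  from tendsto_divide[OF this tendsto_const[of pi]]
  have "(\<lambda>t. sin (pi * t) / t / pi) \<midarrow>0\<rightarrow> 1" by simp
  then have "sinc_pi \<midarrow>0\<rightarrow> 1"
    by (rule Lim_transform_eventually) (auto simp: eventually_at sinc_pi_def mult.commute intro!: exI[of _ 1])
  then show ?thesis using True by (simp add: isCont_def sinc_pi_def)
next
  case False
  have "isCont (\<lambda>t. sin (pi * t) / (pi * t)) x"
    using False by (intro continuous_intros) auto
  moreover have "\<forall>\<^sub>F t in nhds x. sinc_pi t = sin (pi * t) / (pi * t)"
    using t1_space_nhds[OF False] by eventually_elim (simp add: sinc_pi_def)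
  ultimately show ?thesis
    using isCont_cong[of sinc_pi] by simp
qed

text \<open>
  The entries of the matrix of \<open>e\<^sup>t\<^sup>H\<close>, with \<open>(-1)\<^sup>p\<close> written as \<open>cos(\<pi>p)\<close>.  Using \<open>sinc\<close> instead of
  \<open>sin(\<pi>t) / (\<pi>(t + p))\<close> makes the formula correct, and continuous in \<open>t\<close>, also at \<open>t = -p\<close>.
\<close>

definition exp_kernel :: "real \<Rightarrow> int \<Rightarrow> real" where
  "exp_kernel t p = cos (pi * of_int p) * sinc_pi (t + of_int p)"

text \<open>
  The right-hand side does not depend on \<open>p\<close>; this is what makes the sampling expansion work.
\<close>

lemma mult_exp_kernel: "(t + of_int p) * exp_kernel t p = sin (pi * t) / pi"
proof -
  have "(t + of_int p) * exp_kernel t p = cos (pi * of_int p) * ((t + of_int p) * sinc_pi (t + of_int p))"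
    by (simp add: exp_kernel_def)
  also have "\<dots> = sin (pi * t) / pi"
    unfolding mult_sinc_pi by (simp add: distrib_left sin_add)
  finally show ?thesis .
qed

lemma exp_kernel_0: "exp_kernel t 0 = sinc_pi t"
  by (simp add: exp_kernel_def)

lemma exp_kernel_of_int: "exp_kernel (of_int k) p = (if p = - k then cos (pi * of_int k) else 0)"
  using sinc_pi_of_int[of "k + p"] by (auto simp: exp_kernel_def add_eq_0_iff)

lemma exp_kernel_add_int: "cos (pi * of_int k) * exp_kernel s (p + k) = exp_kernel (s + of_int k) p"
proof -
  have "cos (pi * of_int (p + k)) = cos (pi * of_int p) * cos (pi * of_int k)"
    by (simp add: distrib_left cos_add del: cos_npi_int)
  then have "cos (pi * of_int k) * cos (pi * of_int (p + k)) = cos (pi * of_int p)"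
    by simp
  then show ?thesis
    by (simp add: exp_kernel_def add_ac flip: mult.assoc del: cos_npi_int)
qed

lemma exp_kernel_unique:
  assumes "t + of_int p \<noteq> 0" "(t + of_int p) * r = sin (pi * t) / pi"
  shows "exp_kernel t p = r"
  using assms mult_exp_kernel[of t p] by (metis mult_left_cancel)

text \<open>
  For \<open>0 \<le> t < 1\<close> this is \<open>c\<close> times the \<open>n\<close>-th column of the matrix, written so that it can be
  differentiated in norm.
\<close>

definition kernel_vec :: "complex \<Rightarrow> int \<Rightarrow> real \<Rightarrow> ell2" where
  "kernel_vec c n t = (if t = 0 then single c n else (sin (pi * t) / pi) *\<^sub>R recip c (t - of_int n))"

lemma not_Ints_unit_interval: "0 < t \<Longrightarrow> t < 1 \<Longrightarrow> t - of_int n \<notin> \<int>" for t :: real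
proof
  assume t: "0 < t" "t < 1" and "t - of_int n \<in> \<int>"
  then obtain m where "t = of_int (m + n)" by (auto simp: Ints_def algebra_simps)
  with t show False by (metis of_int_0_less_iff of_int_less_1_iff zless_imp_add1_zle add_0 not_le)
qed

lemma ell2_nth_kernel_vec:
  assumes t: "0 \<le> t" "t < 1"
  shows "ell2_nth (kernel_vec c n t) j = of_real (exp_kernel t (j - n)) * c"
proof (cases "t = 0")
  case True
  then show ?thesis
    using exp_kernel_of_int[of 0 "j - n"] by (simp add: kernel_vec_def single.rep_eq)
next
  case False
  have nz: "t + of_int (j - n) \<noteq> 0"
    using not_Ints_plus_int[OF not_Ints_unit_interval[of t n], of j] t False by simp
  have "exp_kernel t (j - n) = sin (pi * t) / pi / (t + of_int (j - n))"
    by (rule exp_kernel_unique[OF nz]) (use nz in simp)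
  then show ?thesis
    using False by (simp add: kernel_vec_def recip.rep_eq scaleR_conv_of_real algebra_simps)
qed

text \<open>
  By the product rule the derivative is \<open>cos(\<pi>t) r - sin(\<pi>t) / \<pi> q\<close>, and this is \<open>H\<close> applied to the
  vector because \<open>sin(\<pi>t) cot(\<pi>(t - n)) = cos(\<pi>t)\<close>.
\<close>

lemma kernel_vec_has_vector_derivative:
  assumes t: "0 < t" "t < 1"
  shows "(kernel_vec c n has_vector_derivative Hilb (kernel_vec c n t)) (at t)"
proof -
  define x where "x = t - of_int n"
  have x: "x \<notin> \<int>" using not_Ints_unit_interval[OF t] by (simp add: x_def)
  have "((\<lambda>t. t - of_int n) has_vector_derivative 1) (at t)"
    by (auto intro!: derivative_eq_intros)
  from vector_diff_chain_at[OF this, of "recip c"] recip_has_vector_derivative[OF x, of c]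
  have r: "((\<lambda>t. recip c (t - of_int n)) has_vector_derivative - recip_sq c x) (at t)"
    by (simp add: o_def x_def)
  have s: "((\<lambda>t. sin (pi * t) / pi) has_real_derivative cos (pi * t)) (at t)"
    by (auto intro!: derivative_eq_intros)
  have "((\<lambda>t. (sin (pi * t) / pi) *\<^sub>R recip c (t - of_int n)) has_vector_derivative
      (sin (pi * t) / pi) *\<^sub>R (- recip_sq c x) + cos (pi * t) *\<^sub>R recip c x) (at t)"
    using has_vector_derivative_scaleR[OF s r] by (simp add: x_def)
  also have "(sin (pi * t) / pi) *\<^sub>R (- recip_sq c x) + cos (pi * t) *\<^sub>R recip c x = Hilb (kernel_vec c n t)"
  proof -
    have "sin (pi * t) * cot (pi * x) = cos (pi * t)"
    proof -
      have "sin (pi * t) \<noteq> 0"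
        using t by (intro less_imp_neq[symmetric] sin_gt_zero) auto
      then show ?thesis
        by (simp add: x_def cot_def right_diff_distrib cos_diff sin_diff)
    qed
    then have "cos (pi * t) = sin (pi * t) / pi * (pi * cot (pi * x))" by simp
    moreover have "Hilb (kernel_vec c n t) = (sin (pi * t) / pi) *\<^sub>R Hilb (recip c x)"
      using t by (simp add: kernel_vec_def x_def blinfun.scaleR_right)
    ultimately show ?thesis
      unfolding Hilb_recip[OF x] by (simp add: scaleR_diff_right)
  qed
  finally have "((\<lambda>t. (sin (pi * t) / pi) *\<^sub>R recip c (t - of_int n)) has_vector_derivative
      Hilb (kernel_vec c n t)) (at t)" .
  then show ?thesis
    by (rule has_vector_derivative_transform_within_open[of _ _ _ "{0<..<1}"])
       (use t in \<open>auto simp: kernel_vec_def\<close>)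
qed

text \<open>
  The coordinate at \<open>n\<close> is \<open>c sinc(t)\<close>, which tends to \<open>c\<close>.  For \<open>0 < t < 1/2\<close> the other coordinates
  are in modulus at most \<open>2 sin(\<pi>t) / \<pi>\<close> times those of \<open>H\<close> applied to the basis vector, hence small in norm.
\<close>

lemma kernel_vec_tendsto_0: "(kernel_vec c n \<longlongrightarrow> single c n) (at_right 0)"
proof -
  let ?E = "\<lambda>t. \<bar>sinc_pi t - 1\<bar> * norm (single c n) + \<bar>sin (pi * t) / pi\<bar> * (2 * norm (Hilb (single c n)))"
  have "norm (kernel_vec c n t - single c n) \<le> ?E t" if t: "0 < t" "t < 1 / 2" for t
  proof -
    define w where "w = kernel_vec c n t - single c n - (sinc_pi t - 1) *\<^sub>R single c n"
    have "norm w \<le> \<bar>sin (pi * t) / pi\<bar> * 2 * norm (Hilb (single c n))"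
    proof (rule norm_ell2_comparison)
      fix j
      have v: "ell2_nth (kernel_vec c n t) j = of_real (exp_kernel t (j - n)) * c"
        by (rule ell2_nth_kernel_vec) (use t in auto)
      show "cmod (ell2_nth w j) \<le> \<bar>sin (pi * t) / pi\<bar> * 2 * cmod (ell2_nth (Hilb (single c n)) j)"
      proof (cases "j = n")
        case True
        then have "ell2_nth w j = 0"
          using exp_kernel_0[of t] v by (simp add: w_def single.rep_eq scaleR_conv_of_real algebra_simps)
        then show ?thesis by simp
      next
        case False
        define p where "p = j - n"
        have "1 \<le> \<bar>p\<bar>" using False by (simp add: p_def)
        then have "1 \<le> \<bar>real_of_int p\<bar>" by linarith
        then have p: "\<bar>real_of_int p\<bar> / 2 \<le> \<bar>t + of_int p\<bar>" "0 < \<bar>real_of_int p\<bar>"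
          using t by linarith+
        have "\<bar>t + of_int p\<bar> * \<bar>exp_kernel t p\<bar> = \<bar>sin (pi * t) / pi\<bar>"
          using mult_exp_kernel[of t p] by (metis abs_mult)
        then have "\<bar>real_of_int p\<bar> / 2 * \<bar>exp_kernel t p\<bar> \<le> \<bar>sin (pi * t) / pi\<bar>"
          using mult_right_mono[OF p(1), of "\<bar>exp_kernel t p\<bar>"] by simp
        then have "\<bar>exp_kernel t p\<bar> \<le> \<bar>sin (pi * t) / pi\<bar> * 2 / \<bar>real_of_int p\<bar>"
          using p(2) by (simp add: pos_le_divide_eq mult_ac)
        from mult_right_mono[OF this norm_ge_zero[of c]]
        have "\<bar>exp_kernel t p\<bar> * cmod c \<le> \<bar>sin (pi * t) / pi\<bar> * 2 * (cmod c / \<bar>real_of_int p\<bar>)"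
          by simp
        moreover have "ell2_nth w j = of_real (exp_kernel t p) * c"
          using False by (simp add: w_def v single.rep_eq p_def)
        moreover have "cmod (ell2_nth (Hilb (single c n)) j) = cmod c / \<bar>real_of_int p\<bar>"
          unfolding ell2_nth_Hilb_single p_def norm_divide norm_of_int ..
        ultimately show ?thesis by (simp only: norm_mult norm_of_real)
      qed
    qed simp
    moreover have "norm (kernel_vec c n t - single c n) \<le> norm w + norm ((sinc_pi t - 1) *\<^sub>R single c n)"
      unfolding w_def by (metis diff_add_cancel norm_triangle_ineq)
    ultimately show ?thesis by simp
  qed
  then have "\<forall>\<^sub>F t in at_right 0. norm (kernel_vec c n t - single c n) \<le> ?E t"
    unfolding eventually_at_right_field by (intro exI[of _ "1 / 2"]) auto
  moreover have "(?E \<longlongrightarrow> 0) (at_right 0)"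
  proof -
    have "(sinc_pi \<longlongrightarrow> 1) (at_right 0)"
      using isCont_sinc_pi[of 0] by (simp add: isCont_def sinc_pi_def filterlim_at_split)
    moreover have "((\<lambda>t. sin (pi * t)) \<longlongrightarrow> sin (pi * 0)) (at_right 0)"
      by (intro tendsto_intros)
    ultimately have "(?E \<longlongrightarrow> \<bar>1 - 1\<bar> * norm (single c n) + \<bar>sin (pi * 0) / pi\<bar> * (2 * norm (Hilb (single c n)))) (at_right 0)"
      by (intro tendsto_intros) auto
    then show ?thesis by simp
  qed
  ultimately have "((\<lambda>t. kernel_vec c n t - single c n) \<longlongrightarrow> 0) (at_right 0)"
    by (rule Lim_null_comparison)
  then show ?thesis by (rule Lim_null[THEN iffD2])
qed

lemma exp_Hilb_single_less_1:
  assumes t: "0 \<le> t" "t < 1"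
  shows "exp_Hilb t (single c n) = kernel_vec c n t"
proof (rule linear_ode_unique[where A = Hilb and b = t and t = t
      and x = "\<lambda>t. exp_Hilb t (single c n)" and y = "kernel_vec c n"])
  show "continuous_on {0..t} (kernel_vec c n)"
    unfolding continuous_on_def
  proof
    fix s assume s: "s \<in> {0..t}"
    show "(kernel_vec c n \<longlongrightarrow> kernel_vec c n s) (at s within {0..t})"
    proof (cases "s = 0")
      case True
      have "(kernel_vec c n \<longlongrightarrow> kernel_vec c n 0) (at 0 within {0<..})"
        using kernel_vec_tendsto_0 by (simp add: kernel_vec_def)
      then have "(kernel_vec c n \<longlongrightarrow> kernel_vec c n 0) (at 0 within {0..})"
        by (simp add: at_within_Ici_at_right)
      then show ?thesis
        unfolding True by (rule tendsto_within_subset) auto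
    next
      case False
      then have "isCont (kernel_vec c n) s"
        using s t by (intro has_vector_derivative_continuous[OF kernel_vec_has_vector_derivative]) auto
      then show ?thesis
        by (simp add: continuous_at_imp_continuous_at_within continuous_within[symmetric])
    qed
  qed
qed (use t in \<open>auto intro!: continuous_on_exp_Hilb_apply exp_Hilb_apply_has_vector_derivative
      kernel_vec_has_vector_derivative simp: kernel_vec_def[of _ _ 0]\<close>)

text \<open>
  The column formula passes to the limit \<open>t \<rightarrow> 1\<close> coordinate by coordinate, which avoids proving that
  \<open>kernel_vec\<close> converges in norm there; the general vector follows by expanding in the basis.
\<close>

lemma exp_Hilb_1: "ell2_nth (exp_Hilb 1 a) m = - ell2_nth a (m + 1)"
proof -
  have coord: "ell2_nth (exp_Hilb 1 (single c n)) j = of_real (exp_kernel 1 (j - n)) * c" for c n j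
  proof (rule tendsto_unique[OF trivial_limit_at_left_real])
    have "((\<lambda>t. exp_Hilb t (single c n)) \<longlongrightarrow> exp_Hilb 1 (single c n)) (at_left 1)"
      using continuous_on_exp_Hilb_apply[of UNIV "single c n"]
      by (simp add: continuous_on_def filterlim_at_split)
    then show "((\<lambda>t. ell2_nth (exp_Hilb t (single c n)) j) \<longlongrightarrow> ell2_nth (exp_Hilb 1 (single c n)) j) (at_left 1)"
      by (rule bounded_linear.tendsto[OF bounded_linear_ell2_nth])
    have "isCont (\<lambda>t. complex_of_real (exp_kernel t (j - n)) * c) 1"
      unfolding exp_kernel_def by (intro continuous_intros isCont_o2[OF _ isCont_sinc_pi])
    then have "((\<lambda>t. complex_of_real (exp_kernel t (j - n)) * c) \<longlongrightarrow> complex_of_real (exp_kernel 1 (j - n)) * c) (at_left 1)"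
      by (simp add: isCont_def filterlim_at_split)
    then show "((\<lambda>t. ell2_nth (exp_Hilb t (single c n)) j) \<longlongrightarrow> complex_of_real (exp_kernel 1 (j - n)) * c) (at_left 1)"
    proof (rule Lim_transform_eventually)
      have "complex_of_real (exp_kernel t (j - n)) * c = ell2_nth (exp_Hilb t (single c n)) j" if "0 < t" "t < 1" for t
        using that by (simp add: exp_Hilb_single_less_1 ell2_nth_kernel_vec)
      then show "\<forall>\<^sub>F t in at_left 1. complex_of_real (exp_kernel t (j - n)) * c = ell2_nth (exp_Hilb t (single c n)) j"
        unfolding eventually_at_left_field by (intro exI[of _ 0]) auto
    qed
  qed
  have "((\<lambda>n. of_real (exp_kernel 1 (m - n)) * ell2_nth a n) has_sum - ell2_nth a (m + 1)) UNIV"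
    by (rule has_sum_finite_neutralI[of "{m + 1}"]) (use exp_kernel_of_int[of 1] in auto)
  then show ?thesis
    using has_sum_apply_single[of "exp_Hilb 1" a m] has_sum_unique unfolding coord by blast
qed

lemma exp_Hilb_of_int: "ell2_nth (exp_Hilb (of_int k) a) m = of_real (cos (pi * of_int k)) * ell2_nth a (m + k)"
proof -
  have step: "ell2_nth (exp_Hilb (of_int (k + 1)) a) m = - ell2_nth (exp_Hilb (of_int k) a) (m + 1)" for k m
    using exp_Hilb_add[of 1 "of_int k" a] by (simp add: exp_Hilb_1 add.commute)
  have cos: "cos (pi * of_int (k + 1)) = - cos (pi * of_int k)" for k
    by (simp add: distrib_left cos_add)
  show ?thesis
  proof (induction k arbitrary: m rule: int_induct[where k = 0])
    case base
    then show ?case by simp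
  next
    case (step1 k)
    show ?case unfolding step cos step1.IH by (simp add: add_ac)
  next
    case (step2 k)
    have "ell2_nth (exp_Hilb (of_int (k - 1)) a) m = - ell2_nth (exp_Hilb (of_int k) a) (m - 1)"
      using step[of "k - 1" "m - 1"] by simp
    moreover have "cos (pi * of_int (k - 1)) = - cos (pi * of_int k)"
      using cos[of "k - 1"] by (simp del: cos_npi_int of_int_diff)
    ultimately show ?case
      unfolding step2.IH by (simp add: algebra_simps del: cos_npi_int of_int_diff)
  qed
qed

text \<open>
  Write \<open>t = s + k\<close> with \<open>k\<close> the integer part.  The operator \<open>e\<^sup>k\<^sup>H\<close> takes a basis vector to a basis vector, to which
  the case \<open>0 \<le> s < 1\<close> applies.
\<close>

lemma exp_Hilb_single: "ell2_nth (exp_Hilb t (single c n)) j = of_real (exp_kernel t (j - n)) * c"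
proof -
  define s k where "s = frac t" and "k = \<lfloor>t\<rfloor>"
  have s: "0 \<le> s" "s < 1"
    by (simp_all add: s_def frac_lt_1)
  have t: "t = s + of_int k"
    by (simp add: s_def k_def frac_def)
  have "exp_Hilb (of_int k) (single c n) = single (of_real (cos (pi * of_int k)) * c) (n - k)"
    by (rule ell2_eqI) (auto simp: exp_Hilb_of_int single.rep_eq)
  then have "exp_Hilb t (single c n) = kernel_vec (of_real (cos (pi * of_int k)) * c) (n - k) s"
    unfolding t exp_Hilb_add[OF s(1)] by (simp add: exp_Hilb_single_less_1[OF s])
  then show ?thesis
    using exp_kernel_add_int[of k s "j - n"]
    by (simp add: ell2_nth_kernel_vec[OF s] t algebra_simps flip: of_real_mult)
qed

lemma has_sum_exp_Hilb:
  "((\<lambda>n. of_real (exp_kernel t (m - n)) * ell2_nth a n) has_sum ell2_nth (exp_Hilb t a) m) UNIV"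
  using has_sum_apply_single[of "exp_Hilb t" a m] unfolding exp_Hilb_single .

lemma norm_exp_Hilb_of_int: "norm (exp_Hilb (of_int k) a) = norm a"
proof -
  have "bij (\<lambda>m::int. m + k)" by (rule bij_betwI[where g = "\<lambda>m. m - k"]) auto
  then have "(\<Sum>\<^sub>\<infinity>m. (cmod (ell2_nth a (m + k)))\<^sup>2) = (\<Sum>\<^sub>\<infinity>m. (cmod (ell2_nth a m))\<^sup>2)"
    by (rule infsum_reindex_bij_betw)
  then show ?thesis
    by (simp add: norm_ell2_def exp_Hilb_of_int norm_mult)
qed

section \<open>The sampling expansion\<close>

text \<open>
  The off-diagonal entries of the expansion: \<open>t sinc(t) / p\<close> comes from \<open>t sinc(t) H\<close>, and the last term
  from the summand with \<open>k = -p\<close>, the only \<open>e\<^sup>k\<^sup>H\<close> whose matrix is not zero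
  in the places with \<open>m - n = p\<close>.
\<close>

lemma exp_kernel_interpolation:
  assumes "p \<noteq> 0"
  shows "exp_kernel t p = t * sinc_pi t / of_int p - t / of_int p * exp_kernel t p"
proof -
  have "(t + of_int p) * exp_kernel t p = t * sinc_pi t"
    unfolding mult_exp_kernel mult_sinc_pi ..
  then show ?thesis
    using assms by (simp add: field_simps)
qed

text \<open>
  Each coefficient is \<open>t\<close> times the product of \<open>1 / k\<close> and \<open>sinc(t - k)\<close>.  Up to sign these are
  coordinates of \<open>H e\<^sub>0\<close> and \<open>e\<^sup>-\<^sup>t\<^sup>H e\<^sub>0\<close>, where \<open>e\<^sub>0\<close> is the basis vector at 0, so both sequences are
  square-summable.
\<close>

lemma abs_summable_sampling_coefficients:
  "(\<lambda>k::int. norm (t / of_int k * sinc_pi (t - of_int k))) summable_on UNIV"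
proof (rule Infinite_Sum.abs_summable_on_comparison_test')
  define b where "b = Hilb (single 1 0)"
  define d where "d = exp_Hilb (- t) (single 1 0)"
  show "(\<lambda>k. \<bar>t\<bar> * ((cmod (ell2_nth b k))\<^sup>2 + (cmod (ell2_nth d k))\<^sup>2)) summable_on UNIV"
    by (intro summable_on_cmult_right summable_on_add summable_on_ell2)
  fix k :: int
  have b: "cmod (ell2_nth b k) = \<bar>1 / of_int k\<bar>"
    by (simp add: b_def ell2_nth_Hilb_single norm_divide)
  have "sinc_pi (t - of_int k) = sinc_pi (- t + of_int k)"
    using sinc_pi_minus[of "t - of_int k"] by simp
  then have d: "cmod (ell2_nth d k) = \<bar>sinc_pi (t - of_int k)\<bar>"
    by (simp add: d_def exp_Hilb_single exp_kernel_def abs_mult)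
  have "\<bar>1 / of_int k\<bar> * \<bar>sinc_pi (t - of_int k)\<bar>
      \<le> \<bar>1 / of_int k\<bar>\<^sup>2 + \<bar>sinc_pi (t - of_int k)\<bar>\<^sup>2"
    using zero_le_power2[of "\<bar>1 / of_int k\<bar> - \<bar>sinc_pi (t - of_int k)\<bar>"]
      mult_nonneg_nonneg[OF abs_ge_zero[of "1 / of_int k"] abs_ge_zero[of "sinc_pi (t - of_int k)"]]
    unfolding power2_diff by linarith
  from mult_left_mono[OF this abs_ge_zero[of t]]
  show "norm (t / of_int k * sinc_pi (t - of_int k)) \<le> \<bar>t\<bar> * ((cmod (ell2_nth b k))\<^sup>2 + (cmod (ell2_nth d k))\<^sup>2)"
    unfolding b d by (simp add: abs_mult)
qed

theorem theorem3p7: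
  fixes a :: ell2 and t :: real
  shows "(\<lambda>k::int. (t / of_int k * sinc_pi (t - of_int k)) *\<^sub>R blinfun_apply (exp_Hilb (of_int k)) a)
           summable_on (UNIV - {0})
       \<and> blinfun_apply (exp_Hilb t) a =
           sinc_pi t *\<^sub>R a + (t * sinc_pi t) *\<^sub>R blinfun_apply Hilb a
           + (\<Sum>\<^sub>\<infinity>k::int\<in>UNIV - {0}.
                (t / of_int k * sinc_pi (t - of_int k)) *\<^sub>R blinfun_apply (exp_Hilb (of_int k)) a)"
proof
  define f where "f k = (t / of_int k * sinc_pi (t - of_int k)) *\<^sub>R exp_Hilb (of_int k) a" for k :: int
  have "(\<lambda>k. norm (f k)) summable_on UNIV"
    using summable_on_cmult_left[OF abs_summable_sampling_coefficients[of t], of "norm a"]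
    by (simp add: f_def norm_exp_Hilb_of_int)
  then have "f summable_on UNIV"
    by (rule abs_summable_summable)
  then have "f summable_on (UNIV - {0})"
    by (rule summable_on_subset_banach) simp
  then show "(\<lambda>k::int. (t / of_int k * sinc_pi (t - of_int k)) *\<^sub>R blinfun_apply (exp_Hilb (of_int k)) a)
      summable_on (UNIV - {0})"
    unfolding f_def .
  define S where "S = infsum f (UNIV - {0})"
  have S: "(f has_sum S) (UNIV - {0})"
    unfolding S_def using \<open>f summable_on (UNIV - {0})\<close> by (rule has_sum_infsum)
  have "exp_Hilb t a = sinc_pi t *\<^sub>R a + (t * sinc_pi t) *\<^sub>R Hilb a + S"
  proof (rule ell2_eqI)
    fix m :: int
    have "((\<lambda>k. ell2_nth (f k) m) has_sum ell2_nth S m) (UNIV - {0})"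
      by (rule has_sum_bounded_linear[OF bounded_linear_ell2_nth S])
    \<comment> \<open>Since \<open>e\<^sup>k\<^sup>H\<close> moves the coordinate \<open>n = m + k\<close> to \<open>m\<close>, the summation runs over \<open>n\<close> from here on.\<close>
    also have "?this \<longleftrightarrow> ((\<lambda>n. - of_real (t / of_int (m - n) * exp_kernel t (m - n)) * ell2_nth a n)
        has_sum ell2_nth S m) (UNIV - {m})"
    proof (rule has_sum_reindex_bij_witness[where i = "\<lambda>n. n - m" and j = "\<lambda>k. m + k"])
      fix k :: int
      show "- of_real (t / of_int (m - (m + k)) * exp_kernel t (m - (m + k))) * ell2_nth a (m + k) = ell2_nth (f k) m"
        by (simp add: f_def exp_Hilb_of_int exp_kernel_def scaleR_conv_of_real)
    qed auto
    finally have series: "((\<lambda>n. - of_real (t / of_int (m - n) * exp_kernel t (m - n)) * ell2_nth a n)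
        has_sum ell2_nth S m) (UNIV - {m})" .
    have "((\<lambda>n. ell2_nth a n / of_int (m - n)) has_sum ell2_nth (Hilb a) m) (UNIV - {m})"
      unfolding ell2_nth_Hilb by (rule has_sum_infsum[OF summable_on_hilbert])
    from has_sum_add[OF has_sum_cmult_right[OF this, of "of_real (t * sinc_pi t)"] series]
    have "((\<lambda>n. of_real (exp_kernel t (m - n)) * ell2_nth a n)
        has_sum (of_real (t * sinc_pi t) * ell2_nth (Hilb a) m + ell2_nth S m)) (UNIV - {m})"
    proof (rule has_sum_cong[THEN iffD1, rotated])
      fix n assume n: "n \<in> UNIV - {m}"
      have "of_real (t * sinc_pi t) * (ell2_nth a n / of_int (m - n))
          + - of_real (t / of_int (m - n) * exp_kernel t (m - n)) * ell2_nth a n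
          = of_real (t * sinc_pi t / of_int (m - n) - t / of_int (m - n) * exp_kernel t (m - n)) * ell2_nth a n"
        by (simp add: algebra_simps)
      also have "\<dots> = of_real (exp_kernel t (m - n)) * ell2_nth a n"
        using exp_kernel_interpolation[of "m - n" t] n by simp
      finally show "of_real (t * sinc_pi t) * (ell2_nth a n / of_int (m - n))
          + - of_real (t / of_int (m - n) * exp_kernel t (m - n)) * ell2_nth a n
          = of_real (exp_kernel t (m - n)) * ell2_nth a n" .
    qed
    then have "((\<lambda>n. of_real (exp_kernel t (m - n)) * ell2_nth a n)
        has_sum (of_real (exp_kernel t (m - m)) * ell2_nth a m
          + (of_real (t * sinc_pi t) * ell2_nth (Hilb a) m + ell2_nth S m))) (insert m (UNIV - {m}))"
      by (intro has_sum_insert) auto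
    then have "((\<lambda>n. of_real (exp_kernel t (m - n)) * ell2_nth a n)
        has_sum ell2_nth (sinc_pi t *\<^sub>R a + (t * sinc_pi t) *\<^sub>R Hilb a + S) m) UNIV"
      by (simp add: exp_kernel_0 scaleR_conv_of_real add_ac)
    with has_sum_exp_Hilb
    show "ell2_nth (exp_Hilb t a) m = ell2_nth (sinc_pi t *\<^sub>R a + (t * sinc_pi t) *\<^sub>R Hilb a + S) m"
      by (rule has_sum_unique)
  qed
  then show "blinfun_apply (exp_Hilb t) a =
      sinc_pi t *\<^sub>R a + (t * sinc_pi t) *\<^sub>R blinfun_apply Hilb a
      + (\<Sum>\<^sub>\<infinity>k::int\<in>UNIV - {0}.
          (t / of_int k * sinc_pi (t - of_int k)) *\<^sub>R blinfun_apply (exp_Hilb (of_int k)) a)"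
    unfolding S_def f_def .
qed

end
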